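(* Let $q=2^m$, let $A,B\in\mathbf{F}_q$ with $\lambda:=B+A^2+A+1\neq 0$, and let $C=C_{A,B}\subset\mathbf{P}^4$ be the projective curve with homogeneous coordinates $(x_0:x_1:x_2:x_3:x_4)$ defined over $\mathbf{F}_q$ by $\sigma_1=x_0$, $\sigma_3=(A+1)x_0^3+\sigma_2x_0$, $\sigma_4=(B+A)x_0^4+(A+1)\sigma_2x_0^2$. Then the curve $C$ is the fibre product over $\mathbf{P}^1$ with affine coordinate $x$ of the three hyperelliptic curves $$y^2+y=\lambda x^3+\lambda/x,\qquad y^2+y=\lambda/x^3+\lambda x,\qquad y^2+y=\lambda x+\lambda/x+A+1 .$$
   Context: Here $\sigma_j$ denotes the $j$-th elementary symmetric function in $x_1,x_2,x_3,x_4$. When $\lambda\ne0$ the curve $C$ is absolutely irreducible with only nodes as singularities. The identification of $C$ with the fibre product is understood up to normalization: the normalization of $C$ is isomorphic over $\mathbf{F}_q$ to the smooth projective model of the fibre product, i.e. the function field of $C$ is $\mathbf{F}_q(x,y_1,y_2,y_3)$ with $y_1^2+y_1=\lambda x^3+\lambda/x$, $y_2^2+y_2=\lambda/x^3+\lambda x$, $y_3^2+y_3=\lambda x+\lambda/x+A+1$, of degree $8$ over $\mathbf{F}_q(x)$. Each hyperelliptic curve means the smooth projective curve with the given affine equation, mapping to $\mathbf{P}^1$ via $x$. *)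

theory Defs
  imports
    "HOL-Library.Poly_Mapping"
    "HOL-Library.Numeral_Type"
    "HOL-Algebra.Algebra"
    "HOL-Algebra.Algebraic_Closure_Type"
begin

section \<open>Polynomials in finitely many variables\<close>

text \<open>
  A polynomial over \<open>'a\<close> in the variables indexed by the finite type \<open>'n\<close> is a finitely supported
  map from exponent vectors to coefficients; the product is the convolution of \<open>Poly_Mapping\<close>.
\<close>

type_synonym ('n, 'a) mpol = "('n \<Rightarrow>\<^sub>0 nat) \<Rightarrow>\<^sub>0 'a"

definition mvar :: "'n \<Rightarrow> ('n, 'a::comm_ring_1) mpol" where
  "mvar i = Poly_Mapping.single (Poly_Mapping.single i 1) 1"

definition mconst :: "'a \<Rightarrow> ('n, 'a::comm_ring_1) mpol" where
  "mconst c = Poly_Mapping.single 0 c"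

text \<open>The zero polynomial is homogeneous of every degree.\<close>

definition homogeneous :: "nat \<Rightarrow> ('n::finite, 'a::comm_ring_1) mpol \<Rightarrow> bool" where
  "homogeneous d f \<longleftrightarrow>
     (\<forall>e \<in> Poly_Mapping.keys f. (\<Sum>i\<in>UNIV. Poly_Mapping.lookup e i) = d)"

abbreviation mpol_ring :: "('n, 'a::comm_ring_1) mpol ring" where
  "mpol_ring \<equiv> ring_of_type_algebra"


section \<open>The function field of an integral projective scheme\<close>

text \<open>
  For a homogeneous prime ideal \<open>I\<close> not containing all the variables, the function field of the closed
  subscheme of projective space cut out by \<open>I\<close> is the degree-zero part of the localization of the
  homogeneous coordinate ring (polynomials modulo \<open>I\<close>) at its nonzero homogeneous elements:
  fractions \<open>f/g\<close> of forms of equal degree with \<open>g \<notin> I\<close>, where \<open>f/g = f'/g'\<close> iff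
  \<open>f g' - f' g \<in> I\<close>. It is defined here for any \<open>I\<close>, but is only meaningful for \<open>I\<close> homogeneous and
  prime.
\<close>

definition frac_pairs ::
    "('n::finite, 'a::comm_ring_1) mpol set \<Rightarrow> (('n, 'a) mpol \<times> ('n, 'a) mpol) set" where
  "frac_pairs I = {(f, g). g \<notin> I \<and> (\<exists>d. homogeneous d f \<and> homogeneous d g)}"

definition frac_rel ::
    "('n::finite, 'a::comm_ring_1) mpol set
      \<Rightarrow> ((('n, 'a) mpol \<times> ('n, 'a) mpol) \<times> (('n, 'a) mpol \<times> ('n, 'a) mpol)) set" where
  "frac_rel I = {((f, g), (f', g')).
     (f, g) \<in> frac_pairs I \<and> (f', g') \<in> frac_pairs I \<and> f * g' - f' * g \<in> I}"

definition frac ::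
    "('n::finite, 'a::comm_ring_1) mpol set \<Rightarrow> ('n, 'a) mpol \<Rightarrow> ('n, 'a) mpol
      \<Rightarrow> (('n, 'a) mpol \<times> ('n, 'a) mpol) set" where
  "frac I f g = frac_rel I `` {(f, g)}"

definition function_field ::
    "('n::finite, 'a::comm_ring_1) mpol set \<Rightarrow> (('n, 'a) mpol \<times> ('n, 'a) mpol) set ring" where
  "function_field I =
     \<lparr> carrier = frac_pairs I // frac_rel I,
       monoid.mult = (\<lambda>u v. \<Union>p\<in>u. \<Union>q\<in>v. frac I (fst p * fst q) (snd p * snd q)),
       one = frac I 1 1,
       ring.zero = frac I 0 1,
       add = (\<lambda>u v. \<Union>p\<in>u. \<Union>q\<in>v.
                frac I (fst p * snd q + fst q * snd p) (snd p * snd q)) \<rparr>"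

definition const_fn ::
    "('n::finite, 'a::comm_ring_1) mpol set \<Rightarrow> 'a \<Rightarrow> (('n, 'a) mpol \<times> ('n, 'a) mpol) set" where
  "const_fn I c = frac I (mconst c) 1"


section \<open>Fibre products of Artin--Schreier double covers of the projective line\<close>

text \<open>
  \<open>is_double_cover L F f E y\<close>: inside \<open>L\<close>, the subfield \<open>E\<close> is the quadratic extension of the
  subfield \<open>F\<close> generated by the root \<open>y\<close> of \<open>Y\<^sup>2 + Y = f\<close>. If \<open>F = k(x)\<close> is the rational function
  field, then \<open>E\<close> is the function field of the smooth projective curve \<open>y\<^sup>2 + y = f(x)\<close>, and the
  inclusion of \<open>F\<close> in \<open>E\<close> is the covering of the projective line given by \<open>x\<close>.
\<close>

definition is_double_cover ::
    "('b, 'c) ring_scheme \<Rightarrow> 'b set \<Rightarrow> 'b \<Rightarrow> 'b set \<Rightarrow> 'b \<Rightarrow> bool" where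
  "is_double_cover L F f E y \<longleftrightarrow>
     y \<in> carrier L \<and> y [^]\<^bsub>L\<^esub> (2::nat) \<oplus>\<^bsub>L\<^esub> y = f \<and>
     E = generate_field L (F \<union> {y}) \<and> ring.dimension L 2 F E"

text \<open>
  \<open>is_fibre_product L k x f1 f2 f3\<close>: the field \<open>L\<close> is the function field of the smooth projective
  model of the fibre product, over the projective line over \<open>k\<close> with affine coordinate \<open>x\<close>, of the
  three double covers \<open>y\<^sup>2 + y = f\<^sub>j\<close>. The degree condition says that the canonical surjection onto
  \<open>L\<close> from the tensor product over \<open>k(x)\<close> of the three quadratic function fields (the ring of the
  generic fibre of the fibre product, of dimension \<open>8\<close> over \<open>k(x)\<close>) is an isomorphism.
\<close>

definition is_fibre_product ::
    "('b, 'c) ring_scheme \<Rightarrow> 'b set \<Rightarrow> 'b \<Rightarrow> 'b \<Rightarrow> 'b \<Rightarrow> 'b \<Rightarrow> bool" where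
  "is_fibre_product L k x f1 f2 f3 \<longleftrightarrow>
     field L \<and> subfield k L \<and> x \<in> carrier L \<and> ring.transcendental L k x \<and>
     (let F = generate_field L (k \<union> {x}) in
        f1 \<in> F \<and> f2 \<in> F \<and> f3 \<in> F \<and>
        (\<exists>E1 E2 E3 y1 y2 y3.
           is_double_cover L F f1 E1 y1 \<and>
           is_double_cover L F f2 E2 y2 \<and>
           is_double_cover L F f3 E3 y3 \<and>
           generate_field L (k \<union> {x, y1, y2, y3}) = carrier L \<and>
           ring.dimension L 8 F (carrier L)))"


section \<open>The projective curve\<close>

text \<open>
  The homogeneous coordinates of four-dimensional projective space are indexed by the five-element
  type \<open>5\<close>. The elementary symmetric polynomials involve only the variables \<open>1, 2, 3, 4\<close>, not \<open>0\<close>.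
\<close>

definition esym :: "nat \<Rightarrow> (5, 'a::comm_ring_1) mpol" where
  "esym j = (\<Sum>S | S \<subseteq> {1, 2, 3, 4} \<and> card S = j. \<Prod>i\<in>S. mvar i)"

definition curve_ideal :: "'a \<Rightarrow> 'a \<Rightarrow> (5, 'a::comm_ring_1) mpol set" where
  "curve_ideal A B = Idl\<^bsub>mpol_ring\<^esub>
     { esym 1 - mvar 0,
       esym 3 - (mconst (A + 1) * mvar 0 ^ 3 + esym 2 * mvar 0),
       esym 4 - (mconst (B + A) * mvar 0 ^ 4 + mconst (A + 1) * esym 2 * mvar 0 ^ 2) }"

end

theory Submission
  imports Defs
begin

text \<open>
  Put \<open>a = x\<^sub>1 + x\<^sub>2\<close>, \<open>b = x\<^sub>3 + x\<^sub>4\<close>, \<open>d = x\<^sub>0 = a + b\<close> and \<open>c = A + 1\<close>. The coordinate on the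
  projective line is \<open>x = b / a\<close>. With \<open>E = x\<^sub>1 x\<^sub>2 + c d\<^sup>2\<close> and \<open>E' = x\<^sub>3 x\<^sub>4 + c d\<^sup>2\<close> the last two
  equations of the curve become
    \<open>a E + b E' + a b d = 0\<close> and \<open>E E' + \<lambda> d\<^sup>4 + c a b d\<^sup>2 = 0\<close>
  in characteristic two. The functions
    \<open>y\<^sub>1 = (x\<^sub>1\<^sup>2 + x\<^sub>1 d + c d\<^sup>2) / (a b)\<close>, \<open>y\<^sub>2 = (x\<^sub>3\<^sup>2 + x\<^sub>3 d + c d\<^sup>2) / (a b)\<close>, \<open>y\<^sub>3 = (x\<^sub>1 + a y\<^sub>1) / d\<close>
  satisfy the three Artin--Schreier equations of the theorem, and conversely
    \<open>x\<^sub>1 = d y\<^sub>3 + a y\<^sub>1\<close>, \<open>x\<^sub>3 = d (y\<^sub>3 + 1) + b y\<^sub>2\<close>.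
  On this point \<open>E = b d y\<^sub>3\<close> and \<open>E' = a d (y\<^sub>3 + 1)\<close>, which makes both equations visible
  (\<open>point_on_curve\<close>).

  The proof therefore chooses \<open>a, b\<close> algebraically independent over the finite field \<open>k\<close> and roots
  \<open>y\<^sub>1, y\<^sub>2, y\<^sub>3\<close> of the three equations in an algebraic closure of \<open>k(a)(b)\<close>. Every nonempty partial sum
  of the three right-hand sides has a pole of odd order at \<open>b = 0\<close> or at \<open>b = \<infinity>\<close>, so it is not of
  the form \<open>g\<^sup>2 + g\<close> with \<open>g\<close> in \<open>k(a)(b)\<close> (\<open>combination_not_in_base\<close>); hence the roots generate a tower of
  three quadratic extensions of \<open>k(a)(b)\<close>, and a fortiori of its subfield \<open>k(x)\<close>.

  What remains is to see that the curve ideal is exactly the kernel of evaluation at this point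
  (\<open>eval_generic_kernel\<close>), so that it is prime and the function field is a field of values. Dividing by
  the cubic equation in \<open>x\<^sub>3\<close>, and then by the quartic in \<open>x\<^sub>1\<close> obtained by eliminating \<open>x\<^sub>3\<close>, shows that
  \<open>a\<^sup>m b\<^sup>n p\<close> is, modulo the ideal, a combination of the eight monomials \<open>x\<^sub>1\<^sup>i x\<^sub>3\<^sup>j\<close> with \<open>i < 4\<close>, \<open>j < 2\<close> over
  \<open>k[a, b]\<close>. Their values are linearly independent because the tower has degree eight. If \<open>p\<close> vanishes
  at the point, then \<open>a\<^sup>m b\<^sup>n p\<close> lies in the ideal, and so does \<open>p\<close>, because \<open>a\<close> and \<open>b\<close> are
  nonzerodivisors modulo the ideal: the two equations remain coprime on the hyperplane \<open>a = 0\<close>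
  (\<open>sum12_nonzerodivisor\<close>), and exchanging the two pairs of coordinates exchanges \<open>a\<close> and \<open>b\<close>.
\<close>

section \<open>Evaluation homomorphisms\<close>

text \<open>Homomorphisms between rings given as types, so that type-class rewriting is available on both sides.\<close>

definition unital_hom :: "('a::comm_ring_1 \<Rightarrow> 'b::comm_ring_1) \<Rightarrow> bool" where
  "unital_hom h \<longleftrightarrow> h 1 = 1 \<and> (\<forall>x y. h (x + y) = h x + h y) \<and> (\<forall>x y. h (x * y) = h x * h y)"

lemma unital_homI:
  assumes "h 1 = 1" "\<And>x y. h (x + y) = h x + h y" "\<And>x y. h (x * y) = h x * h y"
  shows "unital_hom h"
  using assms by (auto simp: unital_hom_def)

lemma unital_hom_simps:
  assumes "unital_hom h"
  shows "h 1 = 1" "h (x + y) = h x + h y" "h (x * y) = h x * h y"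
    "h 0 = 0" "h (- x) = - h x" "h (x - y) = h x - h y" "h (x ^ n) = h x ^ n"
proof -
  show 1: "h 1 = 1" and a: "h (x + y) = h x + h y" and m: "h (x * y) = h x * h y" for x y
    using assms by (auto simp: unital_hom_def)
  show z: "h 0 = 0"
    using a[of 0 0] by simp
  show u: "h (- x) = - h x" for x
    using a[of x "- x"] z by (simp add: eq_neg_iff_add_eq_0 add.commute)
  show "h (x - y) = h x - h y"
    using a[of x "- y"] u[of y] by simp
  show "h (x ^ n) = h x ^ n"
    by (induction n) (auto simp: 1 m)
qed

lemma unital_hom_compose: "unital_hom g \<Longrightarrow> unital_hom h \<Longrightarrow> unital_hom (\<lambda>x. g (h x))"
  by (simp add: unital_hom_def)

lemma unital_hom_const_poly: "unital_hom h \<Longrightarrow> unital_hom (\<lambda>x. [:h x:])"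
  by (rule unital_homI) (auto simp: unital_hom_simps one_pCons)

text \<open>Nested, this evaluates elements of iterated univariate polynomial rings, which serve below as
  models of the ring in several variables.\<close>

definition peval :: "('a::comm_ring_1 \<Rightarrow> 'b::comm_ring_1) \<Rightarrow> 'b \<Rightarrow> 'a poly \<Rightarrow> 'b" where
  "peval h x p = poly (map_poly h p) x"

lemma peval_pCons:
  assumes "unital_hom h"
  shows "peval h x (pCons c p) = h c + x * peval h x p"
  using assms by (simp add: peval_def map_poly_pCons unital_hom_simps)

lemma peval_0: "peval h x 0 = 0"
  by (simp add: peval_def)

lemma peval_hom:
  assumes "unital_hom h"
  shows "unital_hom (peval h x)"
proof -
  note s = peval_pCons[OF assms] peval_0 unital_hom_simps[OF assms]
  have 1: "peval h x 1 = 1"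
    by (simp add: one_pCons s)
  have a: "peval h x (p + q) = peval h x p + peval h x q" for p q
    by (induction p q rule: poly_induct2) (auto simp: s algebra_simps)
  have sm: "peval h x (smult c q) = h c * peval h x q" for c q
    by (induction q) (auto simp: s algebra_simps)
  have "peval h x (p * q) = peval h x p * peval h x q" for p q
    by (induction p) (auto simp: s a sm algebra_simps)
  with 1 a show ?thesis
    by (intro unital_homI)
qed

lemma mpol_single:
  "Poly_Mapping.single e c = (mconst c * (\<Prod>i\<in>UNIV. mvar i ^ Poly_Mapping.lookup e i) :: ('n::finite, 'a::comm_ring_1) mpol)"
proof -
  have pow: "mvar i ^ k = (Poly_Mapping.single (Poly_Mapping.single i k) 1 :: ('n, 'a) mpol)" for i k
    by (induction k) (simp_all add: mvar_def mult_single flip: single_add)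
  have "(\<Prod>i\<in>S. mvar i ^ Poly_Mapping.lookup e i)
      = (Poly_Mapping.single (\<Sum>i\<in>S. Poly_Mapping.single i (Poly_Mapping.lookup e i)) 1 :: ('n, 'a) mpol)"
    for S
    by (induction S rule: infinite_finite_induct) (simp_all add: pow mult_single)
  moreover have "(\<Sum>i\<in>UNIV. Poly_Mapping.single i (Poly_Mapping.lookup e i)) = e"
    by (rule poly_mapping_eqI) (simp add: lookup_sum lookup_single when_def)
  ultimately show ?thesis
    by (simp add: mconst_def mult_single)
qed

lemma mconst_hom: "unital_hom (mconst :: 'a::comm_ring_1 \<Rightarrow> ('n, 'a) mpol)"
  by (rule unital_homI) (simp_all add: mconst_def single_add mult_single)

lemma mpol_sum_singles:
  fixes p :: "('n::finite, 'a::comm_ring_1) mpol"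
  shows "p = (\<Sum>e\<in>Poly_Mapping.keys p. Poly_Mapping.single e (Poly_Mapping.lookup p e))"
  by (rule poly_mapping_eqI)
    (auto simp: lookup_sum lookup_single when_def in_keys_iff)

text \<open>Homomorphisms out of the polynomial ring are compared with this rule on constants and variables.\<close>

lemma mpol_induct [case_names const var add mult]:
  fixes p :: "('n::finite, 'a::comm_ring_1) mpol"
  assumes c: "\<And>c. P (mconst c)" and v: "\<And>i. P (mvar i)"
    and a: "\<And>p q. P p \<Longrightarrow> P q \<Longrightarrow> P (p + q)" and m: "\<And>p q. P p \<Longrightarrow> P q \<Longrightarrow> P (p * q)"
  shows "P p"
proof -
  have 1: "P 1" and 0: "P 0"
    using c[of 1] c[of 0] by (simp_all add: unital_hom_simps[OF mconst_hom])
  have pow: "P (mvar i ^ k)" for i k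
    by (induction k) (auto intro: 1 v m)
  have "P (\<Prod>i\<in>S. mvar i ^ Poly_Mapping.lookup e i)" for S and e :: "'n \<Rightarrow>\<^sub>0 nat"
    by (induction S rule: infinite_finite_induct) (auto intro: 1 m pow)
  then have s: "P (Poly_Mapping.single e c)" for e c
    unfolding mpol_single by (intro m c)
  have "P (\<Sum>e\<in>S. Poly_Mapping.single e (Poly_Mapping.lookup p e))" for S
    by (induction S rule: infinite_finite_induct) (auto intro: 0 a s)
  then show ?thesis
    by (metis mpol_sum_singles)
qed

definition mev :: "('a::comm_ring_1 \<Rightarrow> 'b::comm_ring_1) \<Rightarrow> ('n::finite \<Rightarrow> 'b) \<Rightarrow> ('n, 'a) mpol \<Rightarrow> 'b" where
  "mev h v p = (\<Sum>e\<in>Poly_Mapping.keys p. h (Poly_Mapping.lookup p e) * (\<Prod>i\<in>UNIV. v i ^ Poly_Mapping.lookup e i))"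

lemma mev_superset:
  assumes "unital_hom h" "finite S" "Poly_Mapping.keys p \<subseteq> S"
  shows "mev h v p = (\<Sum>e\<in>S. h (Poly_Mapping.lookup p e) * (\<Prod>i\<in>UNIV. v i ^ Poly_Mapping.lookup e i))"
  unfolding mev_def using assms
  by (intro sum.mono_neutral_left) (auto simp: in_keys_iff unital_hom_simps)

lemma mev_single:
  assumes "unital_hom h"
  shows "mev h v (Poly_Mapping.single e c) = h c * (\<Prod>i\<in>UNIV. v i ^ Poly_Mapping.lookup e i)"
  using assms by (simp add: mev_def unital_hom_simps)

lemma mev_const: "unital_hom h \<Longrightarrow> mev h v (mconst c) = h c"
  by (simp add: mconst_def mev_single)

lemma mev_var:
  assumes "unital_hom h"
  shows "mev h v (mvar i) = v i"
proof -
  have "(\<Prod>j\<in>UNIV. v j ^ Poly_Mapping.lookup (Poly_Mapping.single i 1) j) = (\<Prod>j\<in>UNIV. if j = i then v j else 1)"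
    by (rule prod.cong) (auto simp: lookup_single when_def)
  then show ?thesis
    using assms by (simp add: mvar_def mev_single unital_hom_simps)
qed

lemma mev_hom:
  fixes h :: "'a::comm_ring_1 \<Rightarrow> 'b::comm_ring_1" and v :: "'n::finite \<Rightarrow> 'b"
  assumes h: "unital_hom h"
  shows "unital_hom (mev h v)"
proof -
  have a: "mev h v (p + q) = mev h v p + mev h v q" for p q :: "('n, 'a) mpol"
  proof -
    let ?S = "Poly_Mapping.keys p \<union> Poly_Mapping.keys q"
    have "Poly_Mapping.keys (p + q) \<subseteq> ?S"
      by (rule keys_add)
    then show ?thesis
      by (simp add: mev_superset[OF h, of ?S] lookup_add unital_hom_simps[OF h] algebra_simps sum.distrib)
  qed
  have 1: "mev h v 1 = 1"
    using mev_const[OF h, of v 1] by (simp add: unital_hom_simps[OF h] unital_hom_simps[OF mconst_hom])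
  have 0: "mev h v 0 = 0"
    by (simp add: mev_def)
  have sums: "mev h v (\<Sum>i\<in>S. f i) = (\<Sum>i\<in>S. mev h v (f i))" for S :: "'z set" and f :: "'z \<Rightarrow> ('n, 'a) mpol"
    by (induction S rule: infinite_finite_induct) (auto simp: a 0)
  have ss: "mev h v (Poly_Mapping.single e c * Poly_Mapping.single e' c')
      = mev h v (Poly_Mapping.single e c) * mev h v (Poly_Mapping.single e' c')" for e e' c c'
    by (simp add: mult_single mev_single[OF h] lookup_add power_add prod.distrib unital_hom_simps[OF h] algebra_simps)
  have m: "mev h v (p * q) = mev h v p * mev h v q" for p q :: "('n, 'a) mpol"
  proof -
    let ?s = "\<lambda>(p :: ('n, 'a) mpol) e. Poly_Mapping.single e (Poly_Mapping.lookup p e)"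
    have "mev h v ((\<Sum>e\<in>Poly_Mapping.keys p. ?s p e) * (\<Sum>e\<in>Poly_Mapping.keys q. ?s q e))
        = mev h v (\<Sum>e\<in>Poly_Mapping.keys p. ?s p e) * mev h v (\<Sum>e\<in>Poly_Mapping.keys q. ?s q e)"
      by (simp only: sum_product sums ss)
    then show ?thesis
      by (simp only: mpol_sum_singles[symmetric])
  qed
  from 1 a m show ?thesis
    by (intro unital_homI)
qed

section \<open>The equations of the curve in characteristic two\<close>

text \<open>As rewrite rules together with associativity and commutativity, these cancel equal terms in pairs and
  so decide polynomial identities in characteristic two.\<close>

lemma char2:
  fixes x y :: "'r::comm_ring_1"
  assumes "(2::'r) = 0"
  shows "x + x = 0" "x + (x + y) = y" "- x = x" "x - y = x + y"
    "numeral (Num.Bit0 n) = (0::'r)" "numeral (Num.Bit1 n) = (1::'r)"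
proof -
  show xx: "x + x = 0" for x :: 'r
    using assms by (metis mult_2 mult_zero_left)
  show m: "- x = x" for x :: 'r
    using xx[of x] by (simp add: neg_eq_iff_add_eq_0)
  show "x + (x + y) = y"
    by (simp add: xx flip: add.assoc)
  show "x - y = x + y"
    using m[of y] by (metis add_uminus_conv_diff)
  show n0: "numeral (Num.Bit0 n) = (0::'r)" for n
    by (simp add: numeral_Bit0 xx)
  show "numeral (Num.Bit1 n) = (1::'r)"
    by (simp add: numeral_Bit1 xx)
qed

lemma two_eq_0_hom: "unital_hom (h :: 'a::comm_ring_1 \<Rightarrow> 'b::comm_ring_1) \<Longrightarrow> (2::'a) = 0 \<Longrightarrow> (2::'b) = 0"
  by (metis one_add_one unital_hom_simps(1,2,4))

text \<open>Translation by \<open>1\<close> permutes the field, so the sum of all elements equals itself plus the cardinality.\<close>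

lemma card_power_2_imp_two_eq_0:
  assumes "CARD('a::{field, finite}) = 2 ^ m"
  shows "(2::'a) = 0"
proof -
  have "bij_betw (\<lambda>x::'a. x + 1) UNIV UNIV"
    by (rule bij_betw_byWitness[of _ "\<lambda>x. x - 1"]) auto
  then have "(\<Sum>x::'a\<in>UNIV. x + 1) = (\<Sum>x\<in>UNIV. x)"
    by (rule sum.reindex_bij_betw)
  then have "of_nat (CARD('a)) = (0::'a)"
    by (simp add: sum.distrib)
  with assms have "(2::'a) ^ m = 0"
    by simp
  then show ?thesis
    by (metis power_not_zero)
qed

text \<open>Splitting by whether the subset contains \<open>x\<close> computes elementary symmetric functions of an explicit
  index set one element at a time.\<close>

lemma esym_sum_insert:
  fixes f :: "'i \<Rightarrow> 'r::comm_ring_1"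
  assumes "finite A" "x \<notin> A"
  shows "(\<Sum>S | S \<subseteq> insert x A \<and> card S = Suc j. \<Prod>i\<in>S. f i)
    = (\<Sum>S | S \<subseteq> A \<and> card S = Suc j. \<Prod>i\<in>S. f i) + f x * (\<Sum>S | S \<subseteq> A \<and> card S = j. \<Prod>i\<in>S. f i)"
proof -
  let ?P = "\<lambda>j. {S. S \<subseteq> A \<and> card S = j}"
  have fin: "finite (?P k)" for k
    using assms(1) by simp
  have fS: "finite S" if "S \<subseteq> A" for S
    using that assms(1) by (rule finite_subset)
  have eq: "{S. S \<subseteq> insert x A \<and> card S = Suc j} = ?P (Suc j) \<union> insert x ` ?P j"
  proof (intro subset_antisym subsetI)
    fix S assume S: "S \<in> {S. S \<subseteq> insert x A \<and> card S = Suc j}"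
    show "S \<in> ?P (Suc j) \<union> insert x ` ?P j"
    proof (cases "x \<in> S")
      case True
      then have "S = insert x (S - {x})" "S - {x} \<in> ?P j"
        using S by auto
      then show ?thesis
        by blast
    qed (use S in auto)
  next
    fix S assume "S \<in> ?P (Suc j) \<union> insert x ` ?P j"
    then show "S \<in> {S. S \<subseteq> insert x A \<and> card S = Suc j}"
      using assms fS by (auto simp: card_insert_if)
  qed
  have inj: "inj_on (insert x) (?P j)"
    using assms(2) by (auto simp: inj_on_def insert_ident)
  have "(\<Sum>S\<in>insert x ` ?P j. prod f S) = (\<Sum>S\<in>?P j. f x * prod f S)"
    unfolding sum.reindex[OF inj] o_def
    by (rule sum.cong) (use assms(2) fS in \<open>auto intro!: prod.insert\<close>)
  then show ?thesis
    unfolding eq using assms(2)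
    by (subst sum.union_disjoint) (auto simp: fin sum_distrib_left)
qed

lemma esym_sum_0:
  fixes f :: "'i \<Rightarrow> 'r::comm_ring_1"
  assumes "finite A"
  shows "(\<Sum>S | S \<subseteq> A \<and> card S = 0. \<Prod>i\<in>S. f i) = 1"
proof -
  have "{S. S \<subseteq> A \<and> card S = 0} = {{}}"
    using assms by (auto dest: finite_subset)
  then show ?thesis
    by simp
qed

lemma esym_sum_empty:
  "(\<Sum>S | S \<subseteq> {} \<and> card S = Suc j. \<Prod>i\<in>S. f i) = (0::'r::comm_ring_1)"
  by (rule sum.neutral) auto

lemma esym_explicit:
  shows "esym 1 = (mvar 1 + mvar 2 + mvar 3 + mvar 4 :: (5, 'a::comm_ring_1) mpol)"
    and "esym 2 = (mvar 1 * mvar 2 + mvar 3 * mvar 4 + (mvar 1 + mvar 2) * (mvar 3 + mvar 4) :: (5, 'a) mpol)"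
    and "esym 3 = (mvar 1 * mvar 2 * (mvar 3 + mvar 4) + mvar 3 * mvar 4 * (mvar 1 + mvar 2) :: (5, 'a) mpol)"
    and "esym 4 = (mvar 1 * mvar 2 * (mvar 3 * mvar 4) :: (5, 'a) mpol)"
proof -
  have d: "(1::5) \<notin> {2, 3, 4}" "(2::5) \<notin> {3, 4}" "(3::5) \<notin> {4}" "(4::5) \<notin> {}"
    by simp_all
  have n: "1 = Suc 0" "2 = Suc (Suc 0)" "3 = Suc (Suc (Suc 0))" "4 = Suc (Suc (Suc (Suc 0)))"
    by simp_all
  note e = esym_def n esym_sum_insert[OF _ d(1)] esym_sum_insert[OF _ d(2)]
    esym_sum_insert[OF _ d(3)] esym_sum_insert[OF _ d(4)] esym_sum_0 esym_sum_empty finite_insert finite.emptyI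
  show "esym 1 = (mvar 1 + mvar 2 + mvar 3 + mvar 4 :: (5, 'a) mpol)"
    by (simp only: e) (simp add: algebra_simps)
  show "esym 2 = (mvar 1 * mvar 2 + mvar 3 * mvar 4 + (mvar 1 + mvar 2) * (mvar 3 + mvar 4) :: (5, 'a) mpol)"
    by (simp only: e) (simp add: algebra_simps)
  show "esym 3 = (mvar 1 * mvar 2 * (mvar 3 + mvar 4) + mvar 3 * mvar 4 * (mvar 1 + mvar 2) :: (5, 'a) mpol)"
    by (simp only: e) (simp add: algebra_simps)
  show "esym 4 = (mvar 1 * mvar 2 * (mvar 3 * mvar 4) :: (5, 'a) mpol)"
    by (simp only: e) (simp add: algebra_simps)
qed

definition gen1 :: "(5, 'a::comm_ring_1) mpol" where
  "gen1 = esym 1 - mvar 0"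

definition gen2 :: "'a \<Rightarrow> (5, 'a::comm_ring_1) mpol" where
  "gen2 A = esym 3 - (mconst (A + 1) * mvar 0 ^ 3 + esym 2 * mvar 0)"

definition gen3 :: "'a \<Rightarrow> 'a \<Rightarrow> (5, 'a::comm_ring_1) mpol" where
  "gen3 A B = esym 4 - (mconst (B + A) * mvar 0 ^ 4 + mconst (A + 1) * esym 2 * mvar 0 ^ 2)"

lemma ideal_mpol_iff:
  fixes I :: "('n::finite, 'a::comm_ring_1) mpol set"
  shows "ideal I mpol_ring \<longleftrightarrow> 0 \<in> I \<and> (\<forall>p\<in>I. \<forall>q\<in>I. p + q \<in> I) \<and> (\<forall>p\<in>I. \<forall>r. r * p \<in> I)"
proof
  assume I: "ideal I mpol_ring"
  interpret ideal I mpol_ring by (rule I)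
  show "0 \<in> I \<and> (\<forall>p\<in>I. \<forall>q\<in>I. p + q \<in> I) \<and> (\<forall>p\<in>I. \<forall>r. r * p \<in> I)"
    using additive_subgroup.zero_closed[OF is_additive_subgroup] additive_subgroup.a_closed[OF is_additive_subgroup] I_l_closed
    by (auto simp: ring_of_type_algebra_def)
next
  assume *: "0 \<in> I \<and> (\<forall>p\<in>I. \<forall>q\<in>I. p + q \<in> I) \<and> (\<forall>p\<in>I. \<forall>r. r * p \<in> I)"
  show "ideal I mpol_ring"
  proof (rule idealI)
    show "ring (mpol_ring :: ('n, 'a) mpol ring)"
      by (rule ring_from_type_algebra)
    interpret ring "mpol_ring :: ('n, 'a) mpol ring"
      by (rule ring_from_type_algebra)
    have add: "p + q \<in> I" if "p \<in> I" "q \<in> I" for p q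
      using * that by blast
    have neg: "- p \<in> I" if "p \<in> I" for p
      using * that by (metis mult_minus1)
    show "subgroup I (add_monoid mpol_ring)"
    proof (rule add.subgroupI)
      show "\<ominus>\<^bsub>mpol_ring\<^esub> p \<in> I" if p: "p \<in> I" for p
      proof -
        have "\<ominus>\<^bsub>mpol_ring\<^esub> p = - p"
          by (rule minus_equality) (auto simp: ring_of_type_algebra_def)
        then show ?thesis
          using neg[OF p] by simp
      qed
    qed (use * in \<open>auto simp: ring_of_type_algebra_def intro: add\<close>)
  qed (use * in \<open>auto simp: ring_of_type_algebra_def mult.commute\<close>)
qed

lemma curve_ideal_closed:
  shows "0 \<in> curve_ideal A B" "p \<in> curve_ideal A B \<Longrightarrow> q \<in> curve_ideal A B \<Longrightarrow> p + q \<in> curve_ideal A B"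
    "p \<in> curve_ideal A B \<Longrightarrow> r * p \<in> curve_ideal A B" "p \<in> curve_ideal A B \<Longrightarrow> p * r \<in> curve_ideal A B"
    "p \<in> curve_ideal A B \<Longrightarrow> - p \<in> curve_ideal A B"
    "p \<in> curve_ideal A B \<Longrightarrow> q \<in> curve_ideal A B \<Longrightarrow> p - q \<in> curve_ideal A B"
    "gen1 \<in> curve_ideal A B" "gen2 A \<in> curve_ideal A B" "gen3 A B \<in> curve_ideal A B"
    and curve_ideal_is_ideal: "ideal (curve_ideal A B) mpol_ring"
proof -
  interpret ring "mpol_ring :: (5, 'a) mpol ring"
    by (rule ring_from_type_algebra)
  have gens: "curve_ideal A B = Idl\<^bsub>mpol_ring\<^esub> {gen1, gen2 A, gen3 A B}"
    by (simp add: curve_ideal_def gen1_def gen2_def gen3_def)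
  have sub: "S \<subseteq> carrier mpol_ring" for S :: "(5, 'a) mpol set"
    by (simp add: ring_of_type_algebra_def)
  show I: "ideal (curve_ideal A B) mpol_ring"
    unfolding gens by (rule genideal_ideal[OF sub])
  then show "0 \<in> curve_ideal A B" and a: "\<And>p q. p \<in> curve_ideal A B \<Longrightarrow> q \<in> curve_ideal A B \<Longrightarrow> p + q \<in> curve_ideal A B"
    and m: "\<And>p r. p \<in> curve_ideal A B \<Longrightarrow> r * p \<in> curve_ideal A B"
    unfolding ideal_mpol_iff by auto
  from m show "p \<in> curve_ideal A B \<Longrightarrow> p * r \<in> curve_ideal A B" for p r
    by (metis mult.commute)
  from m show n: "p \<in> curve_ideal A B \<Longrightarrow> - p \<in> curve_ideal A B" for p
    by (metis mult_minus1)
  from a n show "p \<in> curve_ideal A B \<Longrightarrow> q \<in> curve_ideal A B \<Longrightarrow> p - q \<in> curve_ideal A B" for p q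
    by (metis add_uminus_conv_diff)
  have "{gen1, gen2 A, gen3 A B} \<subseteq> curve_ideal A B"
    unfolding gens by (rule genideal_self[OF sub])
  then show "gen1 \<in> curve_ideal A B" "gen2 A \<in> curve_ideal A B" "gen3 A B \<in> curve_ideal A B"
    by auto
qed

lemma curve_ideal_eq:
  "curve_ideal A B = {\<alpha> * gen1 + \<beta> * gen2 A + \<gamma> * gen3 A B | \<alpha> \<beta> \<gamma>. True}" (is "_ = ?J")
proof
  interpret ring "mpol_ring :: (5, 'a) mpol ring"
    by (rule ring_from_type_algebra)
  have gens: "curve_ideal A B = Idl\<^bsub>mpol_ring\<^esub> {gen1, gen2 A, gen3 A B}"
    by (simp add: curve_ideal_def gen1_def gen2_def gen3_def)
  have "ideal ?J mpol_ring"
    unfolding ideal_mpol_iff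
  proof (intro conjI ballI allI)
    show "0 \<in> ?J"
      by (auto intro!: exI[of _ 0])
    fix p q assume "p \<in> ?J" "q \<in> ?J"
    then obtain a b c a' b' c' where "p = a * gen1 + b * gen2 A + c * gen3 A B"
        "q = a' * gen1 + b' * gen2 A + c' * gen3 A B"
      by blast
    then have "p + q = (a + a') * gen1 + (b + b') * gen2 A + (c + c') * gen3 A B"
      by (simp add: algebra_simps)
    then show "p + q \<in> ?J"
      by blast
  next
    fix p r assume "p \<in> ?J"
    then obtain a b c where "p = a * gen1 + b * gen2 A + c * gen3 A B"
      by blast
    then have "r * p = (r * a) * gen1 + (r * b) * gen2 A + (r * c) * gen3 A B"
      by (simp add: algebra_simps)
    then show "r * p \<in> ?J"
      by blast
  qed
  moreover have "{gen1, gen2 A, gen3 A B} \<subseteq> ?J"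
  proof -
    have "gen1 = 1 * gen1 + 0 * gen2 A + 0 * gen3 A B" "gen2 A = 0 * gen1 + 1 * gen2 A + 0 * gen3 A B"
      "gen3 A B = 0 * gen1 + 0 * gen2 A + 1 * gen3 A B"
      by simp_all
    then show ?thesis
      by blast
  qed
  ultimately show "curve_ideal A B \<subseteq> ?J"
    unfolding gens by (rule genideal_minimal)
  show "?J \<subseteq> curve_ideal A B"
    by (auto intro!: curve_ideal_closed(2,3,7,8,9))
qed

text \<open>The hyperplane \<open>x\<^sub>0 = x\<^sub>1 + x\<^sub>2 + x\<^sub>3 + x\<^sub>4\<close> in characteristic two, parametrized by the pair sums
  \<open>a = x\<^sub>1 + x\<^sub>2\<close>, \<open>b = x\<^sub>3 + x\<^sub>4\<close> and by \<open>u = x\<^sub>1\<close>, \<open>v = x\<^sub>3\<close>.\<close>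

definition coords :: "'b \<Rightarrow> 'b \<Rightarrow> 'b \<Rightarrow> 'b \<Rightarrow> 5 \<Rightarrow> 'b::comm_ring_1" where
  "coords a b u v i = (if i = 0 then a + b else if i = 1 then u else if i = 2 then u + a
     else if i = 3 then v else v + b)"

lemma coords_simps:
  "coords a b u v 0 = a + b" "coords a b u v 1 = u" "coords a b u v 2 = u + a"
  "coords a b u v 3 = v" "coords a b u v 4 = v + b"
  by (simp_all add: coords_def)

text \<open>In characteristic two this is \<open>x\<^sub>1 x\<^sub>2 + c d\<^sup>2\<close> for \<open>x\<^sub>1 = u\<close> and \<open>x\<^sub>2 = u + a\<close>.\<close>

definition pair_quad :: "'b \<Rightarrow> 'b \<Rightarrow> 'b \<Rightarrow> 'b \<Rightarrow> 'b::comm_ring_1" where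
  "pair_quad c a d u = u ^ 2 + a * u + c * d ^ 2"

text \<open>The second equation of the curve in the coordinates \<open>a, b, u, v\<close>, with \<open>c = A + 1\<close>.\<close>

definition cubic :: "'b \<Rightarrow> 'b \<Rightarrow> 'b \<Rightarrow> 'b \<Rightarrow> 'b \<Rightarrow> 'b::comm_ring_1" where
  "cubic c a b u v = a * pair_quad c a (a + b) u + b * pair_quad c b (a + b) v + a * b * (a + b)"

text \<open>The third equation of the curve in the same coordinates, with \<open>l\<close> the parameter \<open>\<lambda>\<close>.\<close>

definition quartic :: "'b \<Rightarrow> 'b \<Rightarrow> 'b \<Rightarrow> 'b \<Rightarrow> 'b \<Rightarrow> 'b \<Rightarrow> 'b::comm_ring_1" where
  "quartic c l a b u v = pair_quad c a (a + b) u * pair_quad c b (a + b) v + l * (a + b) ^ 4 + c * (a * b * (a + b) ^ 2)"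

text \<open>Completing the two products \<open>x\<^sub>1 x\<^sub>2\<close> and \<open>x\<^sub>3 x\<^sub>4\<close> to \<open>pair_quad\<close> leaves \<open>(A + 1)\<^sup>2 + (B + A)\<close> as coefficient
  of \<open>x\<^sub>0\<^sup>4\<close>; this is where \<open>\<lambda>\<close> comes from.\<close>

lemma mev_gens:
  fixes h :: "'a::comm_ring_1 \<Rightarrow> 'b::comm_ring_1"
  assumes h: "unital_hom h" and two: "(2::'a) = 0" and l: "l = B + A ^ 2 + A + 1"
  shows "mev h (coords a b u v) gen1 = 0"
    and "mev h (coords a b u v) (gen2 A) = cubic (h (A + 1)) a b u v"
    and "mev h (coords a b u v) (gen3 A B) = quartic (h (A + 1)) (h l) a b u v"
proof -
  note c2 = char2[OF two_eq_0_hom[OF h two]]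
  note H = unital_hom_simps[OF mev_hom[OF h]] mev_const[OF h] mev_var[OF h] coords_simps
  show "mev h (coords a b u v) gen1 = 0"
    unfolding gen1_def esym_explicit H by (simp add: c2 algebra_simps)
  show "mev h (coords a b u v) (gen2 A) = cubic (h (A + 1)) a b u v"
    unfolding gen2_def esym_explicit H cubic_def pair_quad_def
    by (simp add: c2 algebra_simps power2_eq_square power3_eq_cube)
  show "mev h (coords a b u v) (gen3 A B) = quartic (h (A + 1)) (h l) a b u v"
  proof -
    have key: "e * f - ((y + x) * D\<^sup>2 + (x + 1) * (e + f + p) * D)
        = (e + (x + 1) * D) * (f + (x + 1) * D) + (y + x\<^sup>2 + x + 1) * D\<^sup>2 + (x + 1) * (p * D)"
      for e f x y D p :: 'b
      by (simp add: c2 algebra_simps power2_eq_square)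
    have e: "u * (u + a) = u\<^sup>2 + a * u" for u a :: 'b
      by (simp add: power2_eq_square algebra_simps)
    have a: "u + (u + a) = a" for u a :: 'b
      by (rule c2)
    have d4: "z ^ 4 = (z\<^sup>2)\<^sup>2" for z :: 'b
      by (simp flip: power_mult)
    show ?thesis
      unfolding gen3_def esym_explicit H quartic_def pair_quad_def l unital_hom_simps[OF h] e a d4 key ..
  qed
qed

section \<open>Pair sums are nonzerodivisors modulo the curve ideal\<close>

lemma cubic_hom: "unital_hom h \<Longrightarrow> h (cubic c a b u v) = cubic (h c) (h a) (h b) (h u) (h v)"
  by (simp add: cubic_def pair_quad_def unital_hom_simps)

lemma quartic_hom: "unital_hom h \<Longrightarrow> h (quartic c l a b u v) = quartic (h c) (h l) (h a) (h b) (h u) (h v)"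
  by (simp add: quartic_def pair_quad_def unital_hom_simps)

lemma index5_cases: "(i::5) \<in> {0, 1, 2, 3, 4}"
proof (cases i)
  case (of_int z)
  then have "z = 0 \<or> z = 1 \<or> z = 2 \<or> z = 3 \<or> z = 4"
    by auto
  then show ?thesis
    using of_int by auto
qed

text \<open>Passing to the coordinates \<open>a, b, u, v\<close> and back only eliminates \<open>x\<^sub>0\<close> by the linear equation, so nothing
  changes modulo the ideal. Membership may thus be tested in any polynomial model of the coordinates.\<close>

lemma coords_retract:
  fixes h :: "'a::comm_ring_1 \<Rightarrow> 'b::comm_ring_1" and \<theta> :: "'b \<Rightarrow> (5, 'a) mpol"
  assumes h: "unital_hom h" and t: "unital_hom \<theta>" and two: "(2::'a) = 0"
    and c: "\<And>x. \<theta> (h x) = mconst x"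
    and v: "\<theta> a = mvar 1 + mvar 2" "\<theta> b = mvar 3 + mvar 4" "\<theta> u = mvar 1" "\<theta> v = mvar 3"
  shows "\<theta> (mev h (coords a b u v) p) - p \<in> curve_ideal A B"
proof (induction p rule: mpol_induct)
  note c2 = char2[OF two_eq_0_hom[OF mconst_hom two]]
  case (var i)
  have "mvar 1 + mvar 2 + (mvar 3 + mvar 4) - mvar 0 = (gen1 :: (5, 'a) mpol)"
    unfolding gen1_def esym_explicit by (simp add: algebra_simps)
  then show ?case
    using curve_ideal_closed(1,7)[of A B] index5_cases[of i]
    by (auto simp: c2(5) mev_var[OF h] coords_simps unital_hom_simps[OF t] v)
next
  case (const x)
  then show ?case
    using curve_ideal_closed(1)[of A B] by (simp add: mev_const[OF h] c)
next
  case (add p q)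
  then have "\<theta> (mev h (coords a b u v) p) - p + (\<theta> (mev h (coords a b u v) q) - q) \<in> curve_ideal A B"
    by (rule curve_ideal_closed)
  then show ?case
    by (simp add: unital_hom_simps[OF t] unital_hom_simps[OF mev_hom[OF h]] algebra_simps)
next
  case (mult p q)
  then have "(\<theta> (mev h (coords a b u v) p) - p) * \<theta> (mev h (coords a b u v) q) + p * (\<theta> (mev h (coords a b u v) q) - q) \<in> curve_ideal A B"
    by (intro curve_ideal_closed(2)[OF curve_ideal_closed(4) curve_ideal_closed(3)])
  then show ?case
    by (simp add: unital_hom_simps[OF t] unital_hom_simps[OF mev_hom[OF h]] algebra_simps)
qed

lemma retract_mem:
  assumes "q - p \<in> curve_ideal A B"
  shows "q \<in> curve_ideal A B \<longleftrightarrow> p \<in> curve_ideal A B"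
  using curve_ideal_closed(6)[OF _ assms, of q] curve_ideal_closed(2)[OF assms, of p] by auto

lemma prime_power_dvd_cancel:
  fixes b :: "'r::idom"
  assumes "prime_elem b" "\<not> b dvd q" "b ^ n dvd q * t"
  shows "b ^ n dvd t"
  using assms(3)
proof (induction n arbitrary: t)
  case (Suc n)
  then have "b dvd q * t"
    by (auto intro: dvd_trans[of b "b ^ Suc n"])
  then obtain s where t: "t = b * s"
    using assms(1,2) by (auto simp: prime_elem_dvd_mult_iff)
  have "b * b ^ n dvd b * (q * s)"
    using Suc.prems unfolding t by (simp add: algebra_simps)
  then have "b ^ n dvd q * s"
    using assms(1) by (simp only: dvd_mult_cancel_left) auto
  then show ?case
    using Suc.IH[of s] unfolding t by (simp add: mult_dvd_mono)
qed simp

text \<open>On the hyperplane \<open>a = 0\<close> the two equations are \<open>b q\<close> and \<open>e q + l b\<^sup>4\<close>. A common prime factor would divide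
  \<open>l b\<^sup>4\<close> and hence be \<open>b\<close>, which divides neither \<open>e\<close> nor \<open>q\<close>; so all relations between the two are the
  obvious ones. The nonvanishing of \<open>\<lambda>\<close> enters here, as the invertibility of \<open>l\<close>.\<close>

lemma coprime_reduced_equations:
  fixes b q e l l' u v :: "'r::idom"
  assumes b: "prime_elem b" "\<not> b dvd q" "\<not> b dvd e" and l: "l' * l = 1"
    and eq: "u * (b * q) = v * (e * q + l * b ^ 4)"
  shows "\<exists>g. u = g * (e * q + l * b ^ 4) \<and> v = g * (b * q)"
proof -
  have b0: "b \<noteq> 0" and q0: "q \<noteq> 0"
    using b by auto
  have "\<not> b dvd e * q + l * b ^ 4"
  proof
    assume "b dvd e * q + l * b ^ 4"
    moreover have "b dvd l * b ^ 4"
      by (simp add: numeral_eq_Suc)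
    ultimately have "b dvd e * q"
      by (simp add: dvd_add_left_iff)
    then show False
      using b by (simp add: prime_elem_dvd_mult_iff)
  qed
  moreover have "b dvd v * (e * q + l * b ^ 4)"
    by (simp flip: eq)
  ultimately obtain w where v: "v = b * w"
    using b(1) by (auto simp: prime_elem_dvd_mult_iff)
  have "b * (u * q) = b * (w * (e * q + l * b ^ 4))"
    using eq unfolding v by (simp add: algebra_simps)
  then have uq: "u * q = w * (e * q + l * b ^ 4)"
    using b0 by (simp only: mult_cancel_left) auto
  then have "b ^ 4 * w = q * (l' * (u - w * e))"
  proof -
    have "b ^ 4 * w = l' * l * (b ^ 4 * w)"
      by (simp add: l)
    also have "\<dots> = l' * (w * (e * q + l * b ^ 4) - w * e * q)"
      by (simp add: algebra_simps)
    also have "\<dots> = l' * (u * q - w * e * q)"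
      by (simp only: uq)
    finally show ?thesis
      by (simp add: algebra_simps)
  qed
  moreover from this have "b ^ 4 dvd l' * (u - w * e)"
    using prime_power_dvd_cancel[OF b(1,2)] by (metis dvd_triv_left)
  ultimately obtain t where "b ^ 4 * w = q * (b ^ 4 * t)"
    by (auto elim: dvdE)
  then have "b ^ 4 * w = b ^ 4 * (q * t)"
    by (simp add: algebra_simps)
  then have w: "w = q * t"
    using b0 by simp
  have "q * u = q * (t * (e * q + l * b ^ 4))"
    using uq unfolding w by (simp add: algebra_simps)
  then have "u = t * (e * q + l * b ^ 4)"
    using q0 by simp
  then show ?thesis
    unfolding v w by (intro exI[of _ t]) (simp add: algebra_simps)
qed

lemma coeff_0_hom: "unital_hom (\<lambda>p :: 'r::comm_ring_1 poly. coeff p 0)"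
  by (rule unital_homI) (auto simp: coeff_mult)

text \<open>Setting the variable to zero in the relation \<open>eq\<close> gives a relation between the reduced equations. As it is an
  obvious one, subtracting its lift \<open>g G\<close>, \<open>- g F\<close> makes both coefficients divisible by the variable.\<close>

lemma variable_nonzerodivisor:
  fixes F G p :: "'r::idom poly"
  assumes cop: "\<And>u v. u * coeff F 0 = v * coeff G 0 \<Longrightarrow> \<exists>g. u = g * coeff G 0 \<and> v = g * coeff F 0"
    and eq: "[:0, 1:] * p = \<alpha> * F + \<beta> * G"
  shows "\<exists>\<alpha>' \<beta>'. p = \<alpha>' * F + \<beta>' * G"
proof -
  note H = unital_hom_simps[OF coeff_0_hom]
  have X: "\<exists>r. q = [:0, 1:] * r" if "coeff q 0 = 0" for q :: "'r poly"
    using that by (cases q) auto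
  have "coeff \<alpha> 0 * coeff F 0 = (- coeff \<beta> 0) * coeff G 0"
    using arg_cong[OF eq, of "\<lambda>p. coeff p 0"] unfolding H by (simp add: add_eq_0_iff2)
  from cop[OF this] obtain g where g: "coeff \<alpha> 0 = g * coeff G 0" "- coeff \<beta> 0 = g * coeff F 0"
    by blast
  have "coeff (\<alpha> - [:g:] * G) 0 = 0" "coeff (\<beta> + [:g:] * F) 0 = 0"
    unfolding H using g by simp_all (metis add.right_inverse)
  then obtain a' b' where "\<alpha> - [:g:] * G = [:0, 1:] * a'" "\<beta> + [:g:] * F = [:0, 1:] * b'"
    using X by metis
  then have ab: "\<alpha> = [:0, 1:] * a' + [:g:] * G" "\<beta> = [:0, 1:] * b' - [:g:] * F"
    by (simp_all add: algebra_simps)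
  have "[:0, 1:] * p = [:0, 1:] * (a' * F + b' * G)"
  proof -
    have "(r * a' + s * G) * F + (r * b' - s * F) * G = r * (a' * F + b' * G)" for r s
      by (simp add: algebra_simps)
    from this[of "[:0, 1:]" "[:g:]"] show ?thesis
      unfolding eq ab .
  qed
  then have "p = a' * F + b' * G"
    by (simp only: mult_cancel_left) simp
  then show ?thesis
    by blast
qed

lemma x_prime_elem: "prime_elem [:0, 1 :: 'a::field:]"
proof (rule prime_elemI)
  have d: "[:0, 1:] dvd p \<longleftrightarrow> poly p 0 = 0" for p :: "'a poly"
    using poly_eq_0_iff_dvd[of p 0] by simp
  show "[:0, 1:] dvd p \<or> [:0, 1:] dvd q" if "[:0, 1:] dvd p * q" for p q :: "'a poly"
    using that by (simp add: d)
  show "\<not> [:0, 1::'a:] dvd 1"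
    by (simp add: d)
qed simp

text \<open>The model used is the iterated polynomial ring in \<open>b\<close>, \<open>x\<^sub>1\<close>, \<open>x\<^sub>3\<close>, \<open>a\<close> with \<open>a\<close> outermost, where reduction to
  \<open>a = 0\<close> is taking the constant coefficient.\<close>

lemma sum12_nonzerodivisor:
  fixes A B l :: "'a::field"
  assumes two: "(2::'a) = 0" and l: "l = B + A ^ 2 + A + 1" "l \<noteq> 0"
    and mem: "(mvar 1 + mvar 2) * p \<in> curve_ideal A B"
  shows "p \<in> curve_ideal A B"
proof -
  define h :: "'a \<Rightarrow> 'a poly poly poly poly" where "h x = [:[:[:[:x:]:]:]:]" for x
  define h0 :: "'a \<Rightarrow> 'a poly poly poly" where "h0 x = [:[:[:x:]:]:]" for x
  define b where "b = [:[:[:0, 1::'a:]:]:]"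
  define u where "u = [:[:0, 1::'a poly:]:]"
  define v where "v = [:0, 1::'a poly poly:]"
  define \<psi> where "\<psi> = mev h (coords [:0, 1:] [:b:] [:u:] [:v:])"
  define \<theta> where "\<theta> = peval (peval (peval (peval (mconst :: 'a \<Rightarrow> (5, 'a) mpol) (mvar 3 + mvar 4)) (mvar 1)) (mvar 3)) (mvar 1 + mvar 2)"
  define F where "F = cubic (h (A + 1)) [:0, 1:] [:b:] [:u:] [:v:]"
  define G where "G = quartic (h (A + 1)) (h l) [:0, 1:] [:b:] [:u:] [:v:]"
  have idh: "unital_hom (\<lambda>x::'a. x)"
    by (rule unital_homI) simp_all
  have h0: "unital_hom h0"
    unfolding h0_def by (intro unital_hom_const_poly idh)
  have h: "unital_hom h"
    unfolding h_def by (intro unital_hom_const_poly idh)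
  have H: "unital_hom \<psi>"
    unfolding \<psi>_def by (rule mev_hom[OF h])
  have p1: "unital_hom (peval (mconst :: 'a \<Rightarrow> (5, 'a) mpol) x)" for x
    by (intro peval_hom mconst_hom)
  have p2: "unital_hom (peval (peval (mconst :: 'a \<Rightarrow> (5, 'a) mpol) x) y)" for x y
    by (intro peval_hom mconst_hom)
  have p3: "unital_hom (peval (peval (peval (mconst :: 'a \<Rightarrow> (5, 'a) mpol) x) y) z)" for x y z
    by (intro peval_hom mconst_hom)
  have T: "unital_hom \<theta>"
    unfolding \<theta>_def by (intro peval_hom mconst_hom)
  note ps = peval_pCons[OF mconst_hom] peval_pCons[OF p1] peval_pCons[OF p2] peval_pCons[OF p3]
    peval_0 unital_hom_simps[OF mconst_hom] unital_hom_simps[OF p1] unital_hom_simps[OF p2] unital_hom_simps[OF p3]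
  have vals: "\<theta> (h x) = mconst x" "\<theta> [:0, 1:] = mvar 1 + mvar 2" "\<theta> [:b:] = mvar 3 + mvar 4"
    "\<theta> [:u:] = mvar 1" "\<theta> [:v:] = mvar 3" for x
    by (simp_all add: \<theta>_def h_def b_def u_def v_def ps)
  have retr: "\<theta> (\<psi> p) - p \<in> curve_ideal A B" for p
    unfolding \<psi>_def by (rule coords_retract[OF h T two vals])
  have gens: "\<psi> gen1 = 0" "\<psi> (gen2 A) = F" "\<psi> (gen3 A B) = G"
    unfolding \<psi>_def F_def G_def using mev_gens[OF h two l(1)] by blast+
  have FG: "\<theta> F \<in> curve_ideal A B" "\<theta> G \<in> curve_ideal A B"
    using retract_mem[OF retr] curve_ideal_closed(8,9) unfolding gens[symmetric] by blast+
  obtain \<alpha> \<beta> \<gamma> where "(mvar 1 + mvar 2) * p = \<alpha> * gen1 + \<beta> * gen2 A + \<gamma> * gen3 A B"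
    using mem unfolding curve_ideal_eq by blast
  then have "\<psi> (mvar 1 + mvar 2) * \<psi> p = \<psi> \<beta> * F + \<psi> \<gamma> * G"
    by (metis (no_types) H gens unital_hom_simps(2,3) mult_zero_right add_0)
  moreover have "\<psi> (mvar 1 + mvar 2) = [:0, 1:]"
  proof -
    have "\<psi> (mvar 1 + mvar 2) = [:u:] + ([:u:] + [:0, 1:])"
      unfolding unital_hom_simps[OF H] by (simp add: \<psi>_def mev_var[OF h] coords_simps)
    also have "\<dots> = [:0, 1:]"
      by (rule char2[OF two_eq_0_hom[OF h two]])
    finally show ?thesis .
  qed
  ultimately have eq: "[:0, 1:] * \<psi> p = \<psi> \<beta> * F + \<psi> \<gamma> * G"
    by simp
  define q where "q = pair_quad (h0 (A + 1)) b b v"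
  define e where "e = pair_quad (h0 (A + 1)) 0 b u"
  have F0: "coeff F 0 = b * q"
    unfolding F_def cubic_hom[OF coeff_0_hom] by (simp add: cubic_def q_def h_def h0_def)
  have G0: "coeff G 0 = e * q + h0 l * b ^ 4"
    unfolding G_def quartic_hom[OF coeff_0_hom] by (simp add: quartic_def q_def e_def h_def h0_def)
  have b: "prime_elem b"
    unfolding b_def by (intro lift_prime_elem_poly x_prime_elem)
  have nb: "\<not> b dvd r" if "coeff (coeff r i) j = 1" for r i j
  proof
    assume "b dvd r"
    then have "[:[:0, 1:]:] dvd coeff r i"
      unfolding b_def by (simp add: const_poly_dvd_iff)
    then have "[:0, 1:] dvd coeff (coeff r i) j"
      by (simp add: const_poly_dvd_iff)
    then show False
      using x_prime_elem[where 'a = 'a] by (simp add: that)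
  qed
  have q: "\<not> b dvd q"
    by (rule nb[of _ 2 0]) (simp add: q_def pair_quad_def b_def v_def h0_def power2_eq_square numeral_eq_Suc)
  have e: "\<not> b dvd e"
    by (rule nb[of _ 0 2]) (simp add: e_def pair_quad_def b_def u_def h0_def power2_eq_square numeral_eq_Suc)
  have l1: "h0 (inverse l) * h0 l = 1"
    using l(2) by (metis h0 unital_hom_simps(1,3) left_inverse)
  obtain \<alpha>' \<beta>' where "\<psi> p = \<alpha>' * F + \<beta>' * G"
    using variable_nonzerodivisor[OF _ eq, unfolded F0 G0, OF coprime_reduced_equations[OF b q e l1]] by blast
  then have "\<theta> (\<psi> p) \<in> curve_ideal A B"
    by (simp only: unital_hom_simps[OF T]) (intro curve_ideal_closed FG)
  then show ?thesis
    using retract_mem[OF retr] by blast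
qed

text \<open>The symmetry of the curve that exchanges the pair sums \<open>a\<close> and \<open>b\<close>.\<close>

definition swap_pairs :: "(5, 'a::comm_ring_1) mpol \<Rightarrow> (5, 'a) mpol" where
  "swap_pairs = mev mconst (\<lambda>i. mvar (if i = 1 then 3 else if i = 2 then 4 else if i = 3 then 1 else if i = 4 then 2 else 0))"

lemma swap_pairs_hom: "unital_hom swap_pairs"
  unfolding swap_pairs_def by (intro mev_hom mconst_hom)

lemma swap_pairs_var: "swap_pairs (mvar 0) = mvar 0" "swap_pairs (mvar 1) = mvar 3"
  "swap_pairs (mvar 2) = mvar 4" "swap_pairs (mvar 3) = mvar 1" "swap_pairs (mvar 4) = mvar 2"
  "swap_pairs (mconst c) = mconst c"
  by (simp_all add: swap_pairs_def mev_var mev_const mconst_hom)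

lemma swap_pairs_invol: "swap_pairs (swap_pairs p) = p"
proof (induction p rule: mpol_induct)
  case (var i)
  show ?case
    using index5_cases[of i] by (auto simp: swap_pairs_var)
qed (simp_all add: swap_pairs_var unital_hom_simps[OF swap_pairs_hom])

lemma swap_pairs_mem:
  assumes "p \<in> curve_ideal A B"
  shows "swap_pairs p \<in> curve_ideal A B"
proof -
  note H = unital_hom_simps[OF swap_pairs_hom] swap_pairs_var
  have e: "swap_pairs (esym 1) = esym 1" "swap_pairs (esym 2) = esym 2"
    "swap_pairs (esym 3) = esym 3" "swap_pairs (esym 4) = esym 4"
    unfolding esym_explicit H by (simp_all add: algebra_simps)
  have "swap_pairs (gen1 :: (5, 'a) mpol) = gen1" "swap_pairs (gen2 A) = gen2 A" "swap_pairs (gen3 A B) = gen3 A B"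
    unfolding gen1_def gen2_def gen3_def H e by simp_all
  moreover obtain \<alpha> \<beta> \<gamma> where "p = \<alpha> * gen1 + \<beta> * gen2 A + \<gamma> * gen3 A B"
    using assms unfolding curve_ideal_eq by blast
  ultimately have "swap_pairs p = swap_pairs \<alpha> * gen1 + swap_pairs \<beta> * gen2 A + swap_pairs \<gamma> * gen3 A B"
    by (simp add: unital_hom_simps[OF swap_pairs_hom])
  then show ?thesis
    unfolding curve_ideal_eq by blast
qed

lemma sum34_nonzerodivisor:
  fixes A B l :: "'a::field"
  assumes two: "(2::'a) = 0" and l: "l = B + A ^ 2 + A + 1" "l \<noteq> 0"
    and mem: "(mvar 3 + mvar 4) * p \<in> curve_ideal A B"
  shows "p \<in> curve_ideal A B"
proof -
  have "(mvar 1 + mvar 2) * swap_pairs p \<in> curve_ideal A B"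
    using swap_pairs_mem[OF mem] by (simp add: unital_hom_simps[OF swap_pairs_hom] swap_pairs_var)
  then have "swap_pairs p \<in> curve_ideal A B"
    by (rule sum12_nonzerodivisor[OF two l])
  from swap_pairs_mem[OF this] show ?thesis
    by (simp add: swap_pairs_invol)
qed

section \<open>Artin--Schreier towers\<close>

definition subfield_set :: "'f::field set \<Rightarrow> bool" where
  "subfield_set S \<longleftrightarrow> 1 \<in> S \<and> (\<forall>x\<in>S. \<forall>y\<in>S. x - y \<in> S) \<and> (\<forall>x\<in>S. \<forall>y\<in>S. x * y \<in> S) \<and> (\<forall>x\<in>S. inverse x \<in> S)"

lemma subfield_set_closed:
  assumes "subfield_set S"
  shows "1 \<in> S" "0 \<in> S" "x \<in> S \<Longrightarrow> y \<in> S \<Longrightarrow> x - y \<in> S" "x \<in> S \<Longrightarrow> y \<in> S \<Longrightarrow> x + y \<in> S"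
    "x \<in> S \<Longrightarrow> y \<in> S \<Longrightarrow> x * y \<in> S" "x \<in> S \<Longrightarrow> inverse x \<in> S" "x \<in> S \<Longrightarrow> - x \<in> S"
    "x \<in> S \<Longrightarrow> y \<in> S \<Longrightarrow> x / y \<in> S" "x \<in> S \<Longrightarrow> x ^ n \<in> S"
proof -
  show 1: "1 \<in> S" and d: "\<And>x y. x \<in> S \<Longrightarrow> y \<in> S \<Longrightarrow> x - y \<in> S"
    and m: "\<And>x y. x \<in> S \<Longrightarrow> y \<in> S \<Longrightarrow> x * y \<in> S" and i: "\<And>x. x \<in> S \<Longrightarrow> inverse x \<in> S"
    using assms by (auto simp: subfield_set_def)
  show 0: "0 \<in> S"
    using d[OF 1 1] by simp
  show u: "- x \<in> S" if "x \<in> S" for x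
    using d[OF 0 that] by simp
  show "x + y \<in> S" if "x \<in> S" "y \<in> S" for x y
    using d[OF that(1) u[OF that(2)]] by simp
  show "x / y \<in> S" if "x \<in> S" "y \<in> S" for x y
    using m[OF that(1) i[OF that(2)]] by (simp add: divide_inverse)
  show "x ^ n \<in> S" if "x \<in> S" for x
    by (induction n) (auto intro: 1 m that)
qed

text \<open>This is the field generated by \<open>y\<close> over \<open>S\<close> when \<open>y\<^sup>2 + y\<close> lies in \<open>S\<close>.\<close>

definition adjoin :: "'f::field set \<Rightarrow> 'f \<Rightarrow> 'f set" where
  "adjoin S y = {u + v * y | u v. u \<in> S \<and> v \<in> S}"

lemma adjoinI: "u \<in> S \<Longrightarrow> v \<in> S \<Longrightarrow> u + v * y \<in> adjoin S y"
  by (auto simp: adjoin_def)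

lemma adjoin_mem:
  assumes "subfield_set S"
  shows "y \<in> adjoin S y" "u \<in> S \<Longrightarrow> u \<in> adjoin S y"
  using adjoinI[of 0 S 1 y] adjoinI[of u S 0 y] subfield_set_closed(1,2)[OF assms] by auto

text \<open>The conjugate of \<open>u + v y\<close> is \<open>u + v + v y\<close>, and their product is in \<open>S\<close>; this gives inverses. If that product
  vanishes, the element is \<open>0\<close> or \<open>v\<close>.\<close>

lemma subfield_set_adjoin:
  fixes y :: "'f::field"
  assumes two: "(2::'f) = 0" and S: "subfield_set S" and y: "y ^ 2 + y \<in> S"
  shows "subfield_set (adjoin S y)"
proof -
  note c = subfield_set_closed[OF S] and c2 = char2[OF two]
  define f where "f = y ^ 2 + y"
  have f: "f \<in> S" and yy: "y * y = f + y"
    using y c2(2)[of y "y ^ 2"] by (simp_all add: f_def power2_eq_square add.commute c2)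
  have mult: "(u + v * y) * (u' + v' * y) = (u * u' + v * v' * f) + (u * v' + v * u' + v * v') * y" for u v u' v'
  proof -
    have "(u + v * y) * (u' + v' * y) = u * u' + (u * v' + v * u') * y + v * v' * (y * y)"
      by (simp add: algebra_simps)
    then show ?thesis
      unfolding yy by (simp add: algebra_simps)
  qed
  have inv: "inverse (u + v * y) \<in> adjoin S y" if u: "u \<in> S" and v: "v \<in> S" for u v
  proof (cases "u + v * y = 0 \<or> u + v * y = v")
    case True
    then show ?thesis
      using adjoin_mem(2)[OF S, of _ y] c v by auto
  next
    case False
    define n where "n = u * (u + v) + v * v * f"
    have "(u + v * y) * ((u + v) + v * y) = n + (u * v + v * (u + v) + v * v) * y"
      unfolding mult n_def ..
    also have "u * v + v * (u + v) + v * v = 0"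
      by (simp add: algebra_simps c2)
    finally have n: "(u + v * y) * ((u + v) + v * y) = n"
      by simp
    have "(u + v) + v * y \<noteq> 0"
    proof
      assume "(u + v) + v * y = 0"
      then have "u + v * y + v + v = v"
        by (simp add: algebra_simps)
      then show False
        using False by (simp add: add.assoc c2)
    qed
    then have n0: "n \<noteq> 0"
      using False n by auto
    then have "inverse (u + v * y) = ((u + v) + v * y) / n"
      using n False by (simp add: field_simps)
    also have "\<dots> = (u + v) / n + v / n * y"
      by (simp add: add_divide_distrib)
    also have "\<dots> \<in> adjoin S y"
      unfolding n_def by (intro adjoinI c u v f)
    finally show ?thesis .
  qed
  show ?thesis
    unfolding subfield_set_def
  proof (intro conjI ballI)
    show "1 \<in> adjoin S y"
      by (intro adjoin_mem S c)
    fix p assume "p \<in> adjoin S y"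
    then obtain u v where p: "p = u + v * y" "u \<in> S" "v \<in> S"
      by (auto simp: adjoin_def)
    show "inverse p \<in> adjoin S y"
      using inv p by simp
    fix q assume "q \<in> adjoin S y"
    then obtain u' v' where q: "q = u' + v' * y" "u' \<in> S" "v' \<in> S"
      by (auto simp: adjoin_def)
    have "p - q = (u - u') + (v - v') * y"
      by (simp add: p q algebra_simps)
    also have "\<dots> \<in> adjoin S y"
      by (intro adjoinI c p q)
    finally show "p - q \<in> adjoin S y" .
    show "p * q \<in> adjoin S y"
      unfolding p q mult by (intro adjoinI c p q f)
  qed
qed

text \<open>For \<open>z = u + v y\<close> the coefficient of \<open>y\<close> in \<open>z\<^sup>2 + z\<close> is \<open>v\<^sup>2 + v\<close>, so \<open>v\<close> is \<open>0\<close> or \<open>1\<close>.\<close>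

lemma artin_schreier_step:
  fixes y z :: "'f::field"
  assumes two: "(2::'f) = 0" and S: "subfield_set S" and y: "y ^ 2 + y \<in> S" "y \<notin> S"
    and z: "z ^ 2 + z \<in> S" "z \<in> adjoin S y"
  shows "z \<in> S \<or> z + y \<in> S"
proof -
  note c = subfield_set_closed[OF S] and c2 = char2[OF two]
  obtain u v where zz: "z = u + v * y" and u: "u \<in> S" and v: "v \<in> S"
    using z(2) by (auto simp: adjoin_def)
  have "z ^ 2 + z = u ^ 2 + u + v ^ 2 * (y ^ 2 + y) + (v ^ 2 + v) * y"
    unfolding zz by (simp add: power2_eq_square algebra_simps c2)
  then have "(v ^ 2 + v) * y = z ^ 2 + z - (u ^ 2 + u + v ^ 2 * (y ^ 2 + y))"
    by simp
  moreover have "\<dots> \<in> S"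
    by (intro c z u v y)
  ultimately have m: "(v ^ 2 + v) * y \<in> S"
    by simp
  have "v ^ 2 + v = 0"
  proof (rule ccontr)
    assume n: "v ^ 2 + v \<noteq> 0"
    then have "y = ((v ^ 2 + v) * y) / (v ^ 2 + v)"
      by simp
    also have "\<dots> \<in> S"
      by (intro c m v)
    finally show False
      using y by simp
  qed
  then have "v * (v + 1) = 0"
    by (simp add: power2_eq_square algebra_simps)
  then have "v = 0 \<or> v + 1 = 0"
    by simp
  then show ?thesis
  proof
    assume "v = 0"
    then show ?thesis
      using zz u by simp
  next
    assume "v + 1 = 0"
    then have "v = 1"
      by (metis add_eq_0_iff c2(3))
    then have "z + y = u"
      by (simp add: zz c2 add.assoc)
    then show ?thesis
      using u by simp
  qed
qed


section \<open>Poles of odd order\<close>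

text \<open>For \<open>g = P / Q\<close> the last hypothesis says \<open>g\<^sup>2 + g = N / t\<^sup>3\<close>. A pole of \<open>g\<^sup>2 + g\<close> at infinity has even order, while that of
  \<open>N / t\<^sup>3\<close> has the odd positive order \<open>deg N - 3\<close>.\<close>

lemma odd_pole_at_infinity:
  fixes P Q N :: "'f::field poly"
  assumes "Q \<noteq> 0" "even (degree N)" "degree N > 3" "[:0, 1:] ^ 3 * (P ^ 2 + P * Q) = N * Q ^ 2"
  shows False
proof -
  have N: "N \<noteq> 0"
    using assms(3) by auto
  have R: "degree (N * Q ^ 2) = degree N + 2 * degree Q" "N * Q ^ 2 \<noteq> 0"
    using N assms(1) by (simp_all add: degree_mult_eq degree_power_eq)
  have S: "P ^ 2 + P * Q \<noteq> 0"
    using R(2) assms(4) by auto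
  have "degree ([:0, 1:] ^ 3 * (P ^ 2 + P * Q)) = degree ([:0, 1::'f:] ^ 3) + degree (P ^ 2 + P * Q)"
    using S by (intro degree_mult_eq) auto
  then have L: "degree N + 2 * degree Q = 3 + degree (P ^ 2 + P * Q)"
    using R assms(4) by (simp add: degree_power_eq)
  show False
  proof (cases "degree P > degree Q")
    case True
    then have "P \<noteq> 0"
      by auto
    then have "degree (P ^ 2 + P * Q) = degree (P ^ 2)"
      using True assms(1) by (intro degree_add_eq_left) (simp add: degree_mult_eq degree_power_eq)
    then have "degree (P ^ 2 + P * Q) = 2 * degree P"
      using \<open>P \<noteq> 0\<close> by (simp add: degree_power_eq)
    then show False
      using L assms(2) by presburger
  next
    case False
    have "degree (P ^ 2 + P * Q) \<le> 2 * degree Q"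
    proof (rule degree_add_le)
      show "degree (P ^ 2) \<le> 2 * degree Q"
        using degree_power_le[of P 2] False by linarith
      show "degree (P * Q) \<le> 2 * degree Q"
        using degree_mult_le[of P Q] False by linarith
    qed
    then show False
      using L assms(3) by linarith
  qed
qed

text \<open>The same parity argument at \<open>t = 0\<close>, where the order is three. It is run as a descent: the equation forces
  \<open>t\<close> to divide both \<open>P\<close> and \<open>Q\<close>, and both can be divided by \<open>t\<close>.\<close>

lemma odd_pole_at_zero:
  fixes P Q N :: "'f::field poly"
  assumes "Q \<noteq> 0" "coeff N 0 \<noteq> 0" "[:0, 1:] ^ 3 * (P ^ 2 + P * Q) = N * Q ^ 2"
  shows False
  using assms(1,3)
proof (induction "degree Q" arbitrary: P Q rule: less_induct)
  case less
  define t :: "'f poly" where "t = [:0, 1:]"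
  have t0: "t \<noteq> 0" "degree t = 1" and pt: "poly t 0 = 0"
    by (simp_all add: t_def)
  have d: "\<exists>r. q = t * r" if "poly q 0 = 0" for q
    using that poly_eq_0_iff_dvd[of q 0] by (auto simp: t_def elim: dvdE)
  have N: "poly N 0 \<noteq> 0"
    using assms(2) by (simp add: poly_0_coeff_0)
  note pw = power2_eq_square power3_eq_cube
  have e0: "t ^ 3 * (P ^ 2 + P * Q) = N * Q ^ 2"
    using less.prems(2) by (simp add: t_def)
  have "poly (N * Q ^ 2) 0 = 0"
    by (simp add: pt flip: e0)
  then obtain R where Q: "Q = t * R"
    using N d[of Q] by auto
  have "t ^ 2 * (t * (P ^ 2 + P * Q)) = t ^ 2 * (N * R ^ 2)"
    using e0 unfolding Q by (simp add: pw algebra_simps)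
  then have e1: "t * (P ^ 2 + P * Q) = N * R ^ 2"
    using t0 by simp
  have "poly (N * R ^ 2) 0 = 0"
    by (simp add: pt flip: e1)
  then obtain T where R: "R = t * T"
    using N d[of R] by auto
  have "t * (P ^ 2 + P * Q) = t * (t * N * T ^ 2)"
    using e1 unfolding R by (simp add: pw algebra_simps)
  then have e2: "P ^ 2 + P * Q = t * N * T ^ 2"
    using t0 by simp
  have "poly (P ^ 2) 0 = 0"
    using arg_cong[OF e2, of "\<lambda>p. poly p 0"] by (simp add: pt Q)
  then obtain U where P: "P = t * U"
    using d[of P] by auto
  have "t ^ 2 * (t ^ 3 * (U ^ 2 + U * R)) = t ^ 2 * (N * R ^ 2)"
    using e0 unfolding P Q by (simp add: pw algebra_simps)
  then have e3: "t ^ 3 * (U ^ 2 + U * R) = N * R ^ 2"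
    by (simp only: mult_cancel_left) (simp add: t0)
  have "R \<noteq> 0"
    using less.prems(1) Q by auto
  moreover from this have "degree R < degree Q"
    unfolding Q by (simp add: degree_mult_eq t0)
  ultimately show False
    using less.hyps[of R U] e3 by (simp add: t_def)
qed

lemma odd_pole_not_artin_schreier:
  fixes g :: "'f::field poly fract" and N :: "'f poly"
  assumes "coeff N 0 \<noteq> 0 \<or> even (degree N) \<and> degree N > 3"
  shows "g ^ 2 + g \<noteq> to_fract N / to_fract [:0, 1:] ^ 3"
proof
  assume eq: "g ^ 2 + g = to_fract N / to_fract [:0, 1:] ^ 3"
  obtain P Q where g: "g = to_fract P / to_fract Q" and Q: "Q \<noteq> 0"
    by (cases g) (auto simp: Fract_conv_to_fract)
  define t :: "'f poly" where "t = [:0, 1:]"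
  have "to_fract t \<noteq> 0" "to_fract Q \<noteq> 0"
    using Q by (simp_all add: t_def)
  then have "to_fract t ^ 3 * (to_fract P ^ 2 + to_fract P * to_fract Q) = to_fract N * to_fract Q ^ 2"
    using eq unfolding g t_def[symmetric] by (simp add: field_simps power2_eq_square)
  then have "to_fract (t ^ 3 * (P ^ 2 + P * Q)) = to_fract (N * Q ^ 2)"
    by (simp add: power2_eq_square power3_eq_cube)
  then have "t ^ 3 * (P ^ 2 + P * Q) = N * Q ^ 2"
    by (simp only: to_fract_eq_iff)
  then show False
    using assms odd_pole_at_infinity[OF Q] odd_pole_at_zero[OF Q] unfolding t_def by blast
qed

section \<open>A generic point of the curve\<close>

text \<open>An algebraic closure of \<open>k(a)(b)\<close>. The subfield \<open>base\<close> below is \<open>k(a)(b)\<close>, and \<open>par_a\<close>, \<open>par_b\<close> are its two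
  independent variables.\<close>

type_synonym 'a genfield = "'a poly fract poly fract alg_closure"

definition embed_poly :: "'a::field poly fract poly \<Rightarrow> 'a genfield" where
  "embed_poly P = to_ac (to_fract P)"

definition embed_const :: "'a::field \<Rightarrow> 'a genfield" where
  "embed_const c = embed_poly [:to_fract [:c:]:]"

definition par_a :: "'a::field genfield" where
  "par_a = embed_poly [:to_fract [:0, 1:]:]"

definition par_b :: "'a::field genfield" where
  "par_b = embed_poly [:0, 1:]"

abbreviation base :: "'a::field genfield set" where
  "base \<equiv> range to_ac"

lemma embed_poly_hom: "unital_hom embed_poly"
  by (rule unital_homI) (simp_all add: embed_poly_def)

lemma embed_poly_eq_0_iff: "embed_poly P = 0 \<longleftrightarrow> P = 0"
  by (simp add: embed_poly_def)

lemma to_fract_hom: "unital_hom to_fract"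
  by (rule unital_homI) simp_all

lemma id_hom: "unital_hom (\<lambda>x. x)"
  by (rule unital_homI) simp_all

lemma embed_const_hom: "unital_hom embed_const"
proof -
  have "unital_hom (\<lambda>c::'a. embed_poly [:to_fract [:c:]:])"
    by (intro unital_hom_compose[OF embed_poly_hom] unital_hom_const_poly unital_hom_compose[OF to_fract_hom] id_hom)
  then show ?thesis
    unfolding embed_const_def .
qed

lemma embed_poly_in_base: "embed_poly P \<in> base"
  by (simp add: embed_poly_def)

lemma base_subfield_set: "subfield_set base"
  unfolding subfield_set_def
  by (auto simp flip: to_ac_diff to_ac_mult to_ac_inverse to_ac_1)

lemma parameters_in_base: "(par_a :: 'a::field genfield) \<in> base" "(par_b :: 'a genfield) \<in> base" "embed_const (c :: 'a) \<in> base"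
  by (simp_all add: par_a_def par_b_def embed_const_def embed_poly_in_base)

lemma parameters_nonzero: "par_a \<noteq> (0 :: 'a::field genfield)" "par_b \<noteq> (0 :: 'a genfield)" "par_a + par_b \<noteq> (0 :: 'a genfield)"
proof -
  show "par_a \<noteq> (0 :: 'a genfield)" "par_b \<noteq> (0 :: 'a genfield)"
    by (simp_all add: par_a_def par_b_def embed_poly_eq_0_iff)
  have "par_a + par_b = embed_poly ([:to_fract [:0, 1::'a:]:] + [:0, 1:])"
    by (simp only: par_a_def par_b_def unital_hom_simps[OF embed_poly_hom])
  then show "par_a + par_b \<noteq> (0 :: 'a genfield)"
    by (simp add: embed_poly_eq_0_iff)
qed

text \<open>The right-hand sides of the three Artin--Schreier equations, in the order of the theorem.\<close>

definition rhs1 :: "'f::field \<Rightarrow> 'f \<Rightarrow> 'f" where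
  "rhs1 l x = l * x ^ 3 + l / x"

definition rhs2 :: "'f::field \<Rightarrow> 'f \<Rightarrow> 'f" where
  "rhs2 l x = l / x ^ 3 + l * x"

definition rhs3 :: "'f::field \<Rightarrow> 'f \<Rightarrow> 'f \<Rightarrow> 'f" where
  "rhs3 c l x = l * x + l / x + c"

definition generic_roots :: "'a::field \<Rightarrow> 'a \<Rightarrow> 'a genfield \<Rightarrow> 'a genfield \<Rightarrow> 'a genfield \<Rightarrow> bool" where
  "generic_roots c l y1 y2 y3 \<longleftrightarrow>
     y1 ^ 2 + y1 = rhs1 (embed_const l) (par_b / par_a) \<and> y2 ^ 2 + y2 = rhs2 (embed_const l) (par_b / par_a) \<and>
     y3 ^ 2 + y3 = rhs3 (embed_const c) (embed_const l) (par_b / par_a)"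

lemma generic_roots_exist:
  obtains y1 y2 y3 where "generic_roots c l y1 y2 (y3 :: 'a::field genfield)"
proof -
  have "\<exists>y. y ^ 2 + y = f" for f :: "'a genfield"
  proof -
    have "\<exists>y. poly [:- f, 1, 1:] y = 0"
      by (rule alg_closed_imp_poly_has_root) simp
    then show ?thesis
      by (auto simp: power2_eq_square algebra_simps)
  qed
  then show ?thesis
    using that unfolding generic_roots_def by metis
qed

text \<open>The right-hand side of the equation for this sum is \<open>N(b) / b\<^sup>3\<close> with \<open>N\<close> over \<open>k(a)\<close>. If \<open>y\<^sub>1\<close> occurs, \<open>N\<close> has degree
  six; otherwise, if \<open>y\<^sub>2\<close> occurs, \<open>N(0) \<noteq> 0\<close>; and for \<open>y\<^sub>3\<close> alone \<open>N\<close> has degree four. Each time there is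
  a pole of odd order.\<close>

lemma combination_not_in_base:
  fixes c l :: "'a::field"
  assumes two: "(2::'a) = 0" and l: "l \<noteq> 0" and y: "generic_roots c l y1 y2 y3"
    and pqr: "p \<or> q \<or> r"
  shows "of_bool p * y1 + of_bool q * y2 + of_bool r * y3 \<notin> base"
proof
  define z where "z = of_bool p * y1 + of_bool q * y2 + of_bool r * y3"
  assume "of_bool p * y1 + of_bool q * y2 + of_bool r * y3 \<in> base"
  then obtain g where g: "z = to_ac g"
    by (auto simp: z_def)
  define L T :: "'a poly fract" where "L = to_fract [:l:]" and "T = to_fract [:0, 1:]"
  define C where "C = to_fract [:c:]"
  have LT: "L \<noteq> 0" "T \<noteq> 0"
    using l by (simp_all add: L_def T_def)
  define l' t c' b' where "l' = to_fract [:L:]" and "t = to_fract [:T:]" and "c' = to_fract [:C:]"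
    and "b' = to_fract [:0, 1 :: 'a poly fract:]"
  have nz: "l' \<noteq> 0" "t \<noteq> 0" "b' \<noteq> 0"
    using LT by (simp_all add: l'_def t_def b'_def)
  \<comment> \<open>\<open>b\<^sup>3\<close> times \<open>p f\<^sub>1 + q f\<^sub>2 + r f\<^sub>3\<close>, as a polynomial in \<open>b\<close>; terms shared by two of the \<open>f\<^sub>i\<close> cancel when both occur\<close>
  define N where "N = [:of_bool q * (L * T ^ 3), 0, of_bool (p \<noteq> r) * (L * T), of_bool r * C, of_bool (q \<noteq> r) * (L / T), 0, of_bool p * (L / T ^ 3):]"
  note c2 = char2[OF two_eq_0_hom[OF embed_const_hom two]]
  have bool: "(of_bool s :: 'a genfield) ^ 2 = of_bool s" for s
    by (cases s) simp_all
  have bool': "of_bool (s \<noteq> s') = (of_bool s + of_bool s' :: 'f)" if "(2::'f::comm_ring_1) = 0" for s s'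
    using that by (cases s; cases s') simp_all
  have ids: "embed_const l = to_ac l'" "embed_const c = to_ac c'" "par_a = to_ac t" "par_b = to_ac b'"
    by (simp_all add: embed_const_def par_a_def par_b_def embed_poly_def l'_def L_def c'_def C_def t_def T_def b'_def)
  have "z ^ 2 + z = of_bool p * (y1 ^ 2 + y1) + of_bool q * (y2 ^ 2 + y2) + of_bool r * (y3 ^ 2 + y3)"
  proof -
    have sq: "(u + v) ^ 2 = u ^ 2 + v ^ 2" for u v :: "'a genfield"
      by (simp add: power2_eq_square algebra_simps c2)
    show ?thesis
      unfolding z_def sq power_mult_distrib bool by (simp add: algebra_simps)
  qed
  also have "\<dots> = of_bool p * rhs1 (embed_const l) (par_b / par_a) + of_bool q * rhs2 (embed_const l) (par_b / par_a) + of_bool r * rhs3 (embed_const c) (embed_const l) (par_b / par_a)"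
    using y by (simp add: generic_roots_def)
  also have "\<dots> = to_ac (of_bool p * rhs1 l' (b' / t) + of_bool q * rhs2 l' (b' / t) + of_bool r * rhs3 c' l' (b' / t))"
    unfolding ids by (cases p; cases q; cases r; simp add: rhs1_def rhs2_def rhs3_def)
  finally have "g ^ 2 + g = of_bool p * rhs1 l' (b' / t) + of_bool q * rhs2 l' (b' / t) + of_bool r * rhs3 c' l' (b' / t)"
    unfolding g by (simp only: to_ac_eq_iff flip: to_ac_power to_ac_add)
  also have "\<dots> = to_fract N / to_fract [:0, 1:] ^ 3"
  proof -
    have tw: "(2::'a poly fract) = 0"
      by (rule two_eq_0_hom[OF unital_hom_compose[OF to_fract_hom unital_hom_const_poly[OF id_hom]] two])
    have C: "to_fract (pCons u P) = to_fract [:u:] + b' * to_fract P" for u :: "'a poly fract" and P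
      by (simp add: b'_def flip: to_fract_mult to_fract_add)
    have D: "to_fract [:u * v:] = to_fract [:u:] * to_fract [:v:]" "to_fract [:u + v:] = to_fract [:u:] + to_fract [:v:]"
      for u v :: "'a poly fract"
      by (simp_all flip: to_fract_mult to_fract_add)
    have B: "to_fract [:of_bool s:] = of_bool s" for s
      by (cases s) (simp_all flip: one_pCons)
    have I: "to_fract [:L / T:] = l' / t" "to_fract [:L / T ^ 3:] = l' / t ^ 3" "to_fract [:T ^ 3:] = t ^ 3"
      using LT by (simp_all add: l'_def t_def field_simps power3_eq_cube flip: to_fract_mult)
    have "to_fract N = of_bool q * (l' * t ^ 3) + b' ^ 2 * ((of_bool p + of_bool r) * (l' * t))
      + b' ^ 3 * (of_bool r * c') + b' ^ 4 * ((of_bool q + of_bool r) * (l' / t)) + b' ^ 6 * (of_bool p * (l' / t ^ 3))"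
      unfolding N_def bool'[OF tw] C[of _ "pCons _ _"] D B I
      by (simp add: l'_def[symmetric] t_def[symmetric] c'_def[symmetric] numeral_eq_Suc algebra_simps)
    then show ?thesis
      unfolding b'_def[symmetric] rhs1_def rhs2_def rhs3_def using nz
      by (simp add: field_simps power2_eq_square numeral_eq_Suc)
  qed
  finally have "g ^ 2 + g = to_fract N / to_fract [:0, 1:] ^ 3" .
  moreover have "coeff N 0 \<noteq> 0 \<or> even (degree N) \<and> degree N > 3"
    using LT pqr by (cases p; cases q; cases r) (auto simp: N_def)
  ultimately show False
    using odd_pole_not_artin_schreier by blast
qed

context
  fixes c l :: "'a::field" and y1 y2 y3 :: "'a genfield"
  assumes two: "(2::'a) = 0" and l: "l \<noteq> 0" and y: "generic_roots c l y1 y2 y3"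
begin

lemma two_genfield: "(2 :: 'a genfield) = 0"
  by (rule two_eq_0_hom[OF embed_const_hom two])

lemma rhs_base: "y1 ^ 2 + y1 \<in> base" "y2 ^ 2 + y2 \<in> base" "y3 ^ 2 + y3 \<in> base"
  using y unfolding generic_roots_def rhs1_def rhs2_def rhs3_def
  by (simp_all add: subfield_set_closed[OF base_subfield_set] parameters_in_base)

lemma sums_not_in_base:
  "y1 \<notin> base" "y2 \<notin> base" "y3 \<notin> base" "y3 + y1 \<notin> base" "y2 + y1 \<notin> base" "y2 + y3 \<notin> base"
  "y2 + y3 + y1 \<notin> base"
  using combination_not_in_base[OF two l y, of True False False] combination_not_in_base[OF two l y, of False True False]
    combination_not_in_base[OF two l y, of False False True] combination_not_in_base[OF two l y, of True False True]
    combination_not_in_base[OF two l y, of True True False] combination_not_in_base[OF two l y, of False True True]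
    combination_not_in_base[OF two l y, of True True True]
  by (simp_all add: ac_simps)

lemma tower1_subfield_set: "subfield_set (adjoin base y1)"
  by (intro subfield_set_adjoin two_genfield base_subfield_set rhs_base)

lemma tower2_subfield_set: "subfield_set (adjoin (adjoin base y1) y3)"
  by (intro subfield_set_adjoin two_genfield tower1_subfield_set adjoin_mem(2)[OF base_subfield_set] rhs_base)

lemma y3_not_in_tower: "y3 \<notin> adjoin base y1"
  using artin_schreier_step[OF two_genfield base_subfield_set rhs_base(1) sums_not_in_base(1) rhs_base(3)] sums_not_in_base by blast

lemma y2_not_in_tower: "y2 \<notin> adjoin (adjoin base y1) y3"
proof
  have m: "u \<in> adjoin base y1" if "u \<in> base" for u
    by (rule adjoin_mem(2)[OF base_subfield_set that])
  assume "y2 \<in> adjoin (adjoin base y1) y3"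
  then have "y2 \<in> adjoin base y1 \<or> y2 + y3 \<in> adjoin base y1"
    by (intro artin_schreier_step[OF two_genfield tower1_subfield_set _ y3_not_in_tower] m rhs_base)
  moreover have "(y2 + y3) ^ 2 + (y2 + y3) \<in> base"
  proof -
    have eq: "(y2 + y3) ^ 2 + (y2 + y3) = (y2 ^ 2 + y2) + (y3 ^ 2 + y3)"
      by (simp add: power2_eq_square algebra_simps char2[OF two_genfield])
    show ?thesis
      unfolding eq by (intro subfield_set_closed(4) base_subfield_set rhs_base)
  qed
  ultimately show False
    using artin_schreier_step[OF two_genfield base_subfield_set rhs_base(1) sums_not_in_base(1)] rhs_base(2) sums_not_in_base by blast
qed

end

section \<open>The curve ideal is the kernel of evaluation at the generic point\<close>

text \<open>The definitions of \<open>y\<^sub>1\<close> and \<open>y\<^sub>3\<close> solved for \<open>x\<^sub>1\<close>. The second pair of coordinates leads to the same equation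
  for \<open>(x\<^sub>3 + b y\<^sub>2) / d\<close> as for \<open>y\<^sub>3\<close>, so this quotient is \<open>y\<^sub>3\<close> or \<open>y\<^sub>3 + 1\<close>; the cubic equation selects \<open>y\<^sub>3 + 1\<close>.\<close>

definition point_x1 :: "'a::field genfield \<Rightarrow> 'a genfield \<Rightarrow> 'a genfield" where
  "point_x1 y1 y3 = y3 * (par_a + par_b) + par_a * y1"

definition point_x3 :: "'a::field genfield \<Rightarrow> 'a genfield \<Rightarrow> 'a genfield" where
  "point_x3 y2 y3 = (y3 + 1) * (par_a + par_b) + par_b * y2"

definition eval_generic :: "'a::field genfield \<Rightarrow> 'a genfield \<Rightarrow> 'a genfield \<Rightarrow> (5, 'a) mpol \<Rightarrow> 'a genfield" where
  "eval_generic y1 y2 y3 = mev embed_const (coords par_a par_b (point_x1 y1 y3) (point_x3 y2 y3))"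

lemma eval_generic_hom: "unital_hom (eval_generic y1 y2 y3)"
  unfolding eval_generic_def by (rule mev_hom[OF embed_const_hom])

definition coef_hom :: "'a::field poly poly \<Rightarrow> 'a genfield" where
  "coef_hom = peval (peval embed_const par_a) par_b"

lemma coef_hom_hom: "unital_hom coef_hom"
  unfolding coef_hom_def by (intro peval_hom embed_const_hom)

text \<open>This identifies \<open>coef_hom\<close> with the inclusion of \<open>k[a][b]\<close> in \<open>k(a)[b]\<close>, which is injective.\<close>

lemma coef_hom_conv_embed_poly: "coef_hom z = embed_poly (map_poly to_fract z)"
proof -
  note s = peval_pCons[OF embed_const_hom] peval_pCons[OF peval_hom[OF embed_const_hom]] peval_0
  have e: "embed_poly (p + q) = embed_poly p + embed_poly q" "embed_poly (p * q) = embed_poly p * embed_poly q" "embed_poly 0 = 0" for p q :: "'a poly fract poly"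
    by (rule unital_hom_simps[OF embed_poly_hom])+
  have 1: "peval embed_const par_a p = embed_poly [:to_fract p:]" for p :: "'a poly"
  proof (induction p)
    case (pCons c p)
    have "to_fract (pCons c p) = to_fract [:c:] + to_fract [:0, 1:] * to_fract p"
      by (simp flip: to_fract_mult to_fract_add)
    then have "[:to_fract (pCons c p):] = [:to_fract [:c:]:] + [:to_fract [:0, 1:]:] * [:to_fract p:]"
      by simp
    then show ?case
      unfolding s pCons.IH by (simp only: embed_const_def par_a_def e)
  qed (simp add: s e)
  show ?thesis
  proof (induction z)
    case (pCons c z)
    have "map_poly to_fract (pCons c z) = [:to_fract c:] + [:0, 1:] * map_poly to_fract z"
      by (simp add: map_poly_pCons)
    then show ?case
      unfolding coef_hom_def s pCons.IH[unfolded coef_hom_def] 1[of c] by (simp only: e par_b_def)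
  qed (simp add: coef_hom_def s e)
qed

lemma coef_hom_eq_0_iff: "coef_hom z = 0 \<longleftrightarrow> z = 0"
  by (simp add: coef_hom_conv_embed_poly embed_poly_eq_0_iff map_poly_eq_0_iff)

lemma coef_hom_base: "coef_hom z \<in> base"
  by (simp add: coef_hom_conv_embed_poly embed_poly_in_base)

lemma adjoin_independent:
  assumes "subfield_set S" "y \<notin> S" "u \<in> S" "v \<in> S" "u + v * y = 0"
  shows "u = 0 \<and> v = 0"
proof -
  have "v = 0"
  proof (rule ccontr)
    assume "v \<noteq> 0"
    then have "y = - u / v"
      using assms(5) by (simp add: field_simps add_eq_0_iff2)
    then show False
      using assms subfield_set_closed(7,8)[OF assms(1)] by auto
  qed
  then show ?thesis
    using assms(5) by simp
qed

lemma degree_less_4_expand: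
  fixes p :: "'r::comm_ring_1 poly"
  assumes "p = 0 \<or> degree p < 4"
  shows "p = [:coeff p 0, coeff p 1, coeff p 2, coeff p 3:]"
proof (rule poly_eqI)
  fix n :: nat
  have "n = 0 \<or> n = 1 \<or> n = 2 \<or> n = 3 \<or> n > 3"
    by linarith
  then show "coeff p n = coeff [:coeff p 0, coeff p 1, coeff p 2, coeff p 3:] n"
    using assms by (auto simp: numeral_eq_Suc coeff_eq_0 coeff_pCons split: nat.splits)
qed

lemma rhs_scaled:
  fixes a b c l :: "'f::field"
  assumes "a \<noteq> 0" "b \<noteq> 0"
  shows "a ^ 2 * rhs1 l (b / a) = l * (a ^ 4 + b ^ 4) / (a * b)"
    and "b ^ 2 * rhs2 l (b / a) = l * (a ^ 4 + b ^ 4) / (a * b)"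
    and "rhs3 c l (b / a) = l * (a ^ 2 + b ^ 2) / (a * b) + c"
proof -
  show "a ^ 2 * rhs1 l (b / a) = l * (a ^ 4 + b ^ 4) / (a * b)"
    using assms by (simp add: rhs1_def field_simps numeral_eq_Suc)
  show "b ^ 2 * rhs2 l (b / a) = l * (a ^ 4 + b ^ 4) / (a * b)"
    using assms by (simp add: rhs2_def field_simps numeral_eq_Suc)
  show "rhs3 c l (b / a) = l * (a ^ 2 + b ^ 2) / (a * b) + c"
    using assms by (simp add: rhs3_def field_simps numeral_eq_Suc)
qed

context
  fixes A B l :: "'a::field" and y1 y2 y3 :: "'a genfield"
  assumes two: "(2::'a) = 0" and l: "l = B + A ^ 2 + A + 1" "l \<noteq> 0" and y: "generic_roots (A + 1) l y1 y2 y3"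
begin

private abbreviation "X1 \<equiv> point_x1 y1 y3"
private abbreviation "X3 \<equiv> point_x3 y2 y3"

text \<open>The equations of \<open>y\<^sub>1\<close> and \<open>y\<^sub>3\<close> contribute the same multiple of \<open>d\<^sup>4 / (a b)\<close>, which cancels in the first identity;
  the second one is the same with \<open>y\<^sub>2\<close>.\<close>

lemma point_pair_quads:
  "pair_quad (embed_const (A + 1)) par_a (par_a + par_b) X1 = (par_a + par_b) * par_b * y3"
  "pair_quad (embed_const (A + 1)) par_b (par_a + par_b) X3 = (par_a + par_b) * par_a * (y3 + 1)"
  "y3 ^ 2 + y3 = embed_const l * (par_a + par_b) ^ 2 / (par_a * par_b) + embed_const (A + 1)"
proof -
  define a b d k where "a = (par_a :: 'a genfield)" and "b = (par_b :: 'a genfield)" and "d = a + b" and "k = embed_const l"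
  have nz: "a \<noteq> 0" "b \<noteq> 0"
    using parameters_nonzero by (simp_all add: a_def b_def)
  note c2 = char2[OF two_eq_0_hom[OF embed_const_hom two]]
  have sq: "(u + v) ^ 2 = u ^ 2 + v ^ 2" for u v :: "'a genfield"
    by (simp add: power2_eq_square algebra_simps c2)
  have d2: "d ^ 2 = a ^ 2 + b ^ 2"
    unfolding d_def sq ..
  have "d ^ 4 = (d ^ 2) ^ 2"
    by (simp flip: power_mult)
  also have "\<dots> = (a ^ 2) ^ 2 + (b ^ 2) ^ 2"
    unfolding d2 sq ..
  also have "\<dots> = a ^ 4 + b ^ 4"
    by (simp flip: power_mult)
  finally have d4: "d ^ 4 = a ^ 4 + b ^ 4" .
  have eqs: "y1 ^ 2 + y1 = rhs1 k (b / a)" "y2 ^ 2 + y2 = rhs2 k (b / a)" "y3 ^ 2 + y3 = rhs3 (embed_const (A + 1)) k (b / a)"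
    using y unfolding generic_roots_def a_def b_def k_def by blast+
  have r1: "a ^ 2 * (y1 ^ 2 + y1) = k * d ^ 4 / (a * b)"
    unfolding eqs d4 by (rule rhs_scaled[OF nz])
  have r2: "b ^ 2 * (y2 ^ 2 + y2) = k * d ^ 4 / (a * b)"
    unfolding eqs d4 by (rule rhs_scaled[OF nz])
  have r3: "y3 ^ 2 + y3 = k * d ^ 2 / (a * b) + embed_const (A + 1)"
    unfolding eqs d2 by (rule rhs_scaled[OF nz])
  then show "y3 ^ 2 + y3 = embed_const l * (par_a + par_b) ^ 2 / (par_a * par_b) + embed_const (A + 1)"
    by (simp add: a_def b_def d_def k_def)
  have r3': "d ^ 2 * (y3 ^ 2 + y3) = k * d ^ 4 / (a * b) + embed_const (A + 1) * d ^ 2"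
    unfolding r3 by (simp add: field_simps power4_eq_xxxx power2_eq_square)
  have "pair_quad (embed_const (A + 1)) a d X1 = d ^ 2 * (y3 ^ 2 + y3) + d ^ 2 * y3 + a ^ 2 * (y1 ^ 2 + y1) + a * d * y3 + embed_const (A + 1) * d ^ 2"
    unfolding pair_quad_def point_x1_def a_def[symmetric] b_def[symmetric] d_def[symmetric]
    by (simp add: power2_eq_square algebra_simps c2)
  also have "\<dots> = d * (d + a) * y3"
    unfolding r1 r3' by (simp add: power2_eq_square algebra_simps c2)
  also have "d + a = b"
    by (simp add: d_def algebra_simps c2)
  finally show "pair_quad (embed_const (A + 1)) par_a (par_a + par_b) X1 = (par_a + par_b) * par_b * y3"
    by (simp add: a_def b_def d_def)
  have "pair_quad (embed_const (A + 1)) b d X3 = d ^ 2 * (y3 ^ 2 + y3) + d ^ 2 * (y3 + 1) + b ^ 2 * (y2 ^ 2 + y2) + b * d * (y3 + 1) + embed_const (A + 1) * d ^ 2"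
    unfolding pair_quad_def point_x3_def a_def[symmetric] b_def[symmetric] d_def[symmetric]
    by (simp add: power2_eq_square algebra_simps c2)
  also have "\<dots> = d * (d + b) * (y3 + 1)"
    unfolding r2 r3' by (simp add: power2_eq_square algebra_simps c2)
  also have "d + b = a"
    by (simp add: d_def algebra_simps c2)
  finally show "pair_quad (embed_const (A + 1)) par_b (par_a + par_b) X3 = (par_a + par_b) * par_a * (y3 + 1)"
    by (simp add: a_def b_def d_def)
qed

lemma point_on_curve: "cubic (embed_const (A + 1)) par_a par_b X1 X3 = 0" "quartic (embed_const (A + 1)) (embed_const l) par_a par_b X1 X3 = 0"
proof -
  note c2 = char2[OF two_eq_0_hom[OF embed_const_hom two]]
  define a b d where "a = (par_a :: 'a genfield)" and "b = (par_b :: 'a genfield)" and "d = a + b"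
  have nz: "a \<noteq> 0" "b \<noteq> 0"
    using parameters_nonzero by (simp_all add: a_def b_def)
  show "cubic (embed_const (A + 1)) par_a par_b X1 X3 = 0"
    unfolding cubic_def point_pair_quads by (simp add: algebra_simps c2)
  have "quartic (embed_const (A + 1)) (embed_const l) par_a par_b X1 X3 = d ^ 2 * (a * b) * (y3 ^ 2 + y3) + embed_const l * d ^ 4 + embed_const (A + 1) * (a * b * d ^ 2)"
    unfolding quartic_def point_pair_quads(1,2) a_def b_def d_def by (simp add: algebra_simps power2_eq_square)
  also have "d ^ 2 * (a * b) * (y3 ^ 2 + y3) = embed_const l * d ^ 4 + embed_const (A + 1) * (a * b * d ^ 2)"
    unfolding point_pair_quads(3) using nz
    by (simp add: a_def[symmetric] b_def[symmetric] d_def[symmetric] field_simps power4_eq_xxxx power2_eq_square)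
  also have "embed_const l * d ^ 4 + embed_const (A + 1) * (a * b * d ^ 2) + embed_const l * d ^ 4 + embed_const (A + 1) * (a * b * d ^ 2) = 0"
    by (simp add: algebra_simps c2)
  finally show "quartic (embed_const (A + 1)) (embed_const l) par_a par_b X1 X3 = 0" .
qed

lemma eval_generic_zero_on_ideal:
  assumes "p \<in> curve_ideal A B"
  shows "eval_generic y1 y2 y3 p = 0"
proof -
  note H = unital_hom_simps[OF eval_generic_hom[of y1 y2 y3]]
  have g: "eval_generic y1 y2 y3 gen1 = 0" "eval_generic y1 y2 y3 (gen2 A) = 0" "eval_generic y1 y2 y3 (gen3 A B) = 0"
    using mev_gens[OF embed_const_hom two l(1), of par_a par_b X1 X3] point_on_curve by (simp_all add: eval_generic_def)
  obtain \<alpha> \<beta> \<gamma> where "p = \<alpha> * gen1 + \<beta> * gen2 A + \<gamma> * gen3 A B"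
    using assms unfolding curve_ideal_eq by blast
  then show ?thesis
    by (simp only: H g) simp
qed

lemma point_x1_tower: "X1 \<in> adjoin (adjoin base y1) y3" "X1 \<notin> adjoin base y1"
proof -
  have m: "u \<in> adjoin base y1" if "u \<in> base" for u
    by (rule adjoin_mem(2)[OF base_subfield_set that])
  note s = subfield_set_closed[OF tower1_subfield_set[OF two l(2) y]]
  have k: "par_a + par_b \<in> adjoin base y1" "par_a * y1 \<in> adjoin base y1"
    by (intro s(4,5) adjoin_mem(1)[OF base_subfield_set] m parameters_in_base)+
  have "X1 = par_a * y1 + (par_a + par_b) * y3"
    by (simp add: point_x1_def algebra_simps)
  then show "X1 \<in> adjoin (adjoin base y1) y3"
    using adjoinI[OF k(2,1)] by simp
  show "X1 \<notin> adjoin base y1"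
  proof
    assume a: "X1 \<in> adjoin base y1"
    have "y3 = (X1 - par_a * y1) / (par_a + par_b)"
      using parameters_nonzero(3)[where 'a = 'a] by (simp add: point_x1_def)
    moreover have "\<dots> \<in> adjoin base y1"
      by (intro s(3,8) a k)
    ultimately show False
      using y3_not_in_tower[OF two l(2) y] by simp
  qed
qed

lemma point_x3_tower: "X3 \<notin> adjoin (adjoin base y1) y3"
proof
  note t = tower1_subfield_set[OF two l(2) y]
  note s = subfield_set_closed[OF tower2_subfield_set[OF two l(2) y]]
  have m: "u \<in> adjoin (adjoin base y1) y3" if "u \<in> base" for u
    by (rule adjoin_mem(2)[OF t adjoin_mem(2)[OF base_subfield_set that]])
  assume a: "X3 \<in> adjoin (adjoin base y1) y3"
  have "y2 = (X3 - (y3 + 1) * (par_a + par_b)) / par_b"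
    using parameters_nonzero(2)[where 'a = 'a] by (simp add: point_x3_def)
  moreover have "\<dots> \<in> adjoin (adjoin base y1) y3"
    by (intro s(1,3,4,5,8) a adjoin_mem(1)[OF t] m parameters_in_base)
  ultimately show False
    using y2_not_in_tower[OF two l(2) y] by simp
qed

text \<open>From \<open>x\<^sub>1\<^sup>2 = d x\<^sub>1 + m\<close> with \<open>m = c d\<^sup>2 + a b y\<^sub>1\<close>, the powers of \<open>x\<^sub>1\<close> are expressed by \<open>1, x\<^sub>1\<close> over the field generated by
  \<open>y\<^sub>1\<close>, and then by \<open>1, y\<^sub>1\<close> over the base; the change of basis is triangular.\<close>

lemma cubic_in_x1_eq_0:
  assumes r: "r0 \<in> base" "r1 \<in> base" "r2 \<in> base" "r3 \<in> base"
    and eq: "r0 + X1 * (r1 + X1 * (r2 + X1 * r3)) = 0"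
  shows "r0 = 0 \<and> r1 = 0 \<and> r2 = 0 \<and> r3 = 0"
proof -
  note c2 = char2[OF two_eq_0_hom[OF embed_const_hom two]]
  define d where "d = par_a + (par_b :: 'a genfield)"
  define m where "m = embed_const (A + 1) * d ^ 2 + par_a * par_b * y1"
  note s = subfield_set_closed[OF base_subfield_set] and s1 = subfield_set_closed[OF tower1_subfield_set[OF two l(2) y]]
  have b: "u \<in> adjoin base y1" if "u \<in> base" for u
    by (rule adjoin_mem(2)[OF base_subfield_set that])
  have d: "d \<in> base"
    unfolding d_def by (intro s parameters_in_base)
  have m1: "m \<in> adjoin base y1"
    unfolding m_def by (intro s1(4,5,9) adjoin_mem(1)[OF base_subfield_set] b d parameters_in_base)
  have sq: "X1 ^ 2 = d * X1 + m"
  proof -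
    have "X1 ^ 2 + par_a * X1 + embed_const (A + 1) * d ^ 2 = d * par_b * y3"
      using point_pair_quads(1) by (simp add: pair_quad_def d_def)
    also have "\<dots> = par_b * (X1 + par_a * y1)"
      by (simp add: point_x1_def d_def algebra_simps c2)
    finally have "X1 ^ 2 + par_a * X1 + embed_const (A + 1) * d ^ 2 + par_a * X1 + embed_const (A + 1) * d ^ 2 = par_b * (X1 + par_a * y1) + par_a * X1 + embed_const (A + 1) * d ^ 2"
      by simp
    then show ?thesis
      by (simp add: m_def d_def algebra_simps c2)
  qed
  have cu: "X1 * X1 ^ 2 = d * X1 ^ 2 + m * X1"
    by (subst sq) (simp add: power2_eq_square algebra_simps)
  have "r0 + X1 * (r1 + X1 * (r2 + X1 * r3)) = r0 + r1 * X1 + r2 * X1 ^ 2 + r3 * (X1 * X1 ^ 2)"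
    by (simp add: power2_eq_square algebra_simps)
  also have "\<dots> = (r0 + r2 * m + r3 * d * m) + (r1 + r2 * d + r3 * (d ^ 2 + m)) * X1"
    unfolding cu unfolding sq by (simp add: power2_eq_square algebra_simps)
  finally have "(r0 + r2 * m + r3 * d * m) + (r1 + r2 * d + r3 * (d ^ 2 + m)) * X1 = 0"
    using eq by simp
  then have e: "r0 + r2 * m + r3 * d * m = 0 \<and> r1 + r2 * d + r3 * (d ^ 2 + m) = 0"
    by (rule adjoin_independent[OF tower1_subfield_set[OF two l(2) y] point_x1_tower(2), rotated 2]) (intro s1(4,5,9) m1 b d r)+
  have "(r1 + r2 * d + r3 * (d ^ 2 + embed_const (A + 1) * d ^ 2)) + (r3 * (par_a * par_b)) * y1 = 0"
    using e by (simp add: m_def algebra_simps)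
  then have "r1 + r2 * d + r3 * (d ^ 2 + embed_const (A + 1) * d ^ 2) = 0 \<and> r3 * (par_a * par_b) = 0"
    by (rule adjoin_independent[OF base_subfield_set sums_not_in_base(1)[OF two l(2) y], rotated 2]) (intro s(4,5,9) d parameters_in_base r)+
  then have r3: "r3 = 0" and r12: "r1 + r2 * d = 0"
    using parameters_nonzero[where 'a = 'a] by auto
  have "(r0 + r2 * (embed_const (A + 1) * d ^ 2)) + (r2 * (par_a * par_b)) * y1 = 0"
    using e by (simp add: m_def r3 algebra_simps)
  then have "r0 + r2 * (embed_const (A + 1) * d ^ 2) = 0 \<and> r2 * (par_a * par_b) = 0"
    by (rule adjoin_independent[OF base_subfield_set sums_not_in_base(1)[OF two l(2) y], rotated 2]) (intro s(4,5,9) d parameters_in_base r)+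
  then show ?thesis
    using parameters_nonzero[where 'a = 'a] r3 r12 by auto
qed

lemma eval_low_degree_eq_0:
  assumes "s = 0 \<or> degree s < 4" "peval coef_hom X1 s = 0"
  shows "s = 0"
proof -
  have s: "s = [:coeff s 0, coeff s 1, coeff s 2, coeff s 3:]"
    by (rule degree_less_4_expand[OF assms(1)])
  have "peval coef_hom X1 [:coeff s 0, coeff s 1, coeff s 2, coeff s 3:] = 0"
    using assms(2) s by simp
  then have "coef_hom (coeff s 0) + X1 * (coef_hom (coeff s 1) + X1 * (coef_hom (coeff s 2) + X1 * coef_hom (coeff s 3))) = 0"
    by (simp add: peval_pCons[OF coef_hom_hom] peval_0)
  from cubic_in_x1_eq_0[OF coef_hom_base coef_hom_base coef_hom_base coef_hom_base this]
  show ?thesis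
    unfolding coef_hom_eq_0_iff using s by simp
qed

lemma peval_X1_tower: "peval coef_hom X1 s \<in> adjoin (adjoin base y1) y3"
proof (induction s)
  note t = tower2_subfield_set[OF two l(2) y]
  case (pCons z s)
  have "coef_hom z \<in> adjoin (adjoin base y1) y3"
    by (intro adjoin_mem(2)[OF tower1_subfield_set[OF two l(2) y]] adjoin_mem(2)[OF base_subfield_set] coef_hom_base)
  then show ?case
    unfolding peval_pCons[OF coef_hom_hom] by (intro subfield_set_closed(4,5)[OF t] point_x1_tower pCons.IH)
next
  note t = tower2_subfield_set[OF two l(2) y]
  case 0
  then show ?case
    by (simp add: peval_0 subfield_set_closed(2)[OF t])
qed

end

lemma degree_less_2_expand:
  fixes p :: "'r::comm_ring_1 poly"
  assumes "p = 0 \<or> degree p < 2"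
  shows "p = [:coeff p 0, coeff p 1:]"
proof (rule poly_eqI)
  fix n :: nat
  have "n = 0 \<or> n = 1 \<or> n > 1"
    by linarith
  then show "coeff p n = coeff [:coeff p 0, coeff p 1:] n"
    using assms by (auto simp: numeral_eq_Suc coeff_eq_0 coeff_pCons split: nat.splits)
qed

lemma pseudo_division:
  fixes f g :: "'r::comm_ring_1 poly"
  assumes "g \<noteq> 0"
  obtains n q r where "smult (lead_coeff g ^ n) f = g * q + r" "r = 0 \<or> degree r < degree g"
proof -
  obtain q r where "pseudo_divmod f g = (q, r)"
    by (cases "pseudo_divmod f g")
  from pseudo_divmod[OF assms this] that show ?thesis
    by blast
qed

lemma mpol_hom_eqI:
  assumes f: "unital_hom f" and g: "unital_hom (g :: (5, 'a::comm_ring_1) mpol \<Rightarrow> 'b::comm_ring_1)"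
    and c: "\<And>x. f (mconst x) = g (mconst x)" and v: "\<And>i. f (mvar i) = g (mvar i)"
  shows "f p = g p"
  by (induction p rule: mpol_induct)
    (simp_all add: c v unital_hom_simps[OF f] unital_hom_simps[OF g])

context
  fixes A B l :: "'a::field" and y1 y2 y3 :: "'a genfield"
  assumes two: "(2::'a) = 0" and l: "l = B + A ^ 2 + A + 1" "l \<noteq> 0" and y: "generic_roots (A + 1) l y1 y2 y3"
begin

private definition "hV = (\<lambda>x::'a. [:[:[:[:x:]:]:]:])"
private definition "aZ = [:[:0, 1::'a:]:]"
private definition "bZ = [:0, 1::'a poly:]"
private definition "uW = [:0, 1::'a poly poly:]"
private definition "vV = [:0, 1::'a poly poly poly:]"
private definition "cZ = [:[:A + 1:]:]"
private definition "lZ = [:[:l:]:]"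
private definition "dZ = aZ + bZ"
private definition "EW = [:cZ * dZ ^ 2, aZ, 1:]"
private definition "HW = smult aZ (EW ^ 2) + smult (aZ * bZ * dZ) EW + [:bZ * lZ * dZ ^ 4 + cZ * aZ * bZ ^ 2 * dZ ^ 2:]"
private definition "FV = cubic (hV (A + 1)) [:[:aZ:]:] [:[:bZ:]:] [:uW:] vV"
private definition "GV = quartic (hV (A + 1)) (hV l) [:[:aZ:]:] [:[:bZ:]:] [:uW:] vV"

private lemma hV_hom: "unital_hom hV"
  unfolding hV_def by (intro unital_hom_const_poly id_hom)

private lemma lift_hom: "unital_hom (\<lambda>z :: 'a poly poly. [:[:z:]:])" "unital_hom (\<lambda>z :: 'a poly poly poly. [:z:])"
  by (intro unital_hom_const_poly id_hom)+

private lemma FV_expand: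
  "FV = [:smult aZ EW + [:bZ * cZ * dZ ^ 2 + aZ * bZ * dZ:], [:bZ ^ 2:], [:bZ:]:]"
  unfolding FV_def cubic_def pair_quad_def hV_def EW_def uW_def vV_def cZ_def[symmetric]
  unfolding dZ_def
  by (simp add: power2_eq_square algebra_simps flip: one_pCons)

private lemma FV_lead: "FV \<noteq> 0" "degree FV = 2" "lead_coeff FV = [:bZ:]"
proof -
  have "bZ \<noteq> 0"
    by (simp add: bZ_def)
  then show "FV \<noteq> 0" "degree FV = 2" "lead_coeff FV = [:bZ:]"
    unfolding FV_expand by simp_all
qed

private lemma HW_lead: "HW \<noteq> 0" "degree HW = 4" "lead_coeff HW = aZ"
proof -
  have a: "aZ \<noteq> 0"
    by (simp add: aZ_def)
  have "HW = [:aZ * (cZ * dZ ^ 2) ^ 2 + aZ * bZ * dZ * (cZ * dZ ^ 2) + (bZ * lZ * dZ ^ 4 + cZ * aZ * bZ ^ 2 * dZ ^ 2),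
      aZ * (2 * (cZ * dZ ^ 2 * aZ)) + aZ * bZ * dZ * aZ, aZ * (2 * (cZ * dZ ^ 2) + aZ ^ 2) + aZ * bZ * dZ, aZ * (2 * aZ), aZ:]"
    unfolding HW_def EW_def by (simp add: power2_eq_square algebra_simps flip: one_pCons)
  with a show "HW \<noteq> 0" "degree HW = 4" "lead_coeff HW = aZ"
    by simp_all
qed

text \<open>Multiplying the third equation by \<open>b\<close> and replacing \<open>b E'\<close> by means of the second one eliminates \<open>x\<^sub>3\<close>.\<close>

private lemma HW_eq: "[:HW:] = [:[:bZ:]:] * GV + [:EW:] * FV"
proof -
  note c2 = char2[OF two_eq_0_hom[OF hV_hom two]]
  define a b d cc ll e f where "a = [:[:aZ:]:]" and "b = [:[:bZ:]:]" and "d = a + b" and "cc = hV (A + 1)" and "ll = hV l"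
    and "e = [:EW:]" and "f = pair_quad cc b d vV"
  have d: "[:[:dZ:]:] = d"
    unfolding dZ_def a_def b_def d_def by simp
  have e: "pair_quad cc a d [:uW:] = e"
  proof -
    have "EW = uW ^ 2 + [:aZ:] * uW + [:cZ:] * [:dZ:] ^ 2"
      unfolding EW_def uW_def by (simp add: power2_eq_square flip: one_pCons)
    then have "e = [:uW:] ^ 2 + [:[:aZ:]:] * [:uW:] + [:[:cZ:]:] * [:[:dZ:]:] ^ 2"
      unfolding e_def by (simp only: unital_hom_simps[OF lift_hom(2)])
    then show ?thesis
      unfolding pair_quad_def d a_def[symmetric] by (simp add: cc_def hV_def cZ_def)
  qed
  have HW: "[:HW:] = a * e ^ 2 + a * b * d * e + (b * ll * d ^ 4 + cc * a * b ^ 2 * d ^ 2)"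
  proof -
    have "HW = [:aZ:] * EW ^ 2 + [:aZ:] * [:bZ:] * [:dZ:] * EW + ([:bZ:] * [:lZ:] * [:dZ:] ^ 4 + [:cZ:] * [:aZ:] * [:bZ:] ^ 2 * [:dZ:] ^ 2)"
      unfolding HW_def by (simp add: poly_const_pow ac_simps)
    then have "[:HW:] = [:[:aZ:]:] * [:EW:] ^ 2 + [:[:aZ:]:] * [:[:bZ:]:] * [:[:dZ:]:] * [:EW:] + ([:[:bZ:]:] * [:[:lZ:]:] * [:[:dZ:]:] ^ 4 + [:[:cZ:]:] * [:[:aZ:]:] * [:[:bZ:]:] ^ 2 * [:[:dZ:]:] ^ 2)"
      by (simp only: unital_hom_simps[OF lift_hom(2)])
    then show ?thesis
      unfolding d a_def[symmetric] b_def[symmetric] e_def[symmetric] by (simp only: cc_def ll_def hV_def cZ_def lZ_def)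
  qed
  have F: "FV = a * e + b * f + a * b * d" and G: "GV = e * f + ll * d ^ 4 + cc * (a * b * d ^ 2)"
    unfolding FV_def GV_def cubic_def quartic_def
    unfolding a_def[symmetric] b_def[symmetric] cc_def[symmetric] ll_def[symmetric]
    unfolding d_def[symmetric] e f_def by simp_all
  define D where "D = d ^ 4"
  show ?thesis
    unfolding HW unfolding F G b_def[symmetric] e_def[symmetric] D_def[symmetric]
    by (simp add: power2_eq_square algebra_simps c2)
qed

private definition "psi = mev hV (coords [:[:aZ:]:] [:[:bZ:]:] [:uW:] vV)"
private definition "theta = peval (peval (peval (peval (mconst :: 'a \<Rightarrow> (5, 'a) mpol) (mvar 1 + mvar 2)) (mvar 3 + mvar 4)) (mvar 1)) (mvar 3)"
private definition "phiV = peval (peval coef_hom (point_x1 y1 y3)) (point_x3 y2 y3)"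

private lemma homs: "unital_hom psi" "unital_hom theta" "unital_hom phiV" "unital_hom (peval coef_hom (point_x1 y1 y3))"
  unfolding psi_def theta_def phiV_def
  by (intro mev_hom hV_hom peval_hom mconst_hom coef_hom_hom)+

private lemma theta_vals: "theta (hV x) = mconst x" "theta [:[:aZ:]:] = mvar 1 + mvar 2" "theta [:[:bZ:]:] = mvar 3 + mvar 4"
  "theta [:uW:] = mvar 1" "theta vV = mvar 3"
proof -
  have p1: "unital_hom (peval (mconst :: 'a \<Rightarrow> (5, 'a) mpol) x)" for x
    by (intro peval_hom mconst_hom)
  have p2: "unital_hom (peval (peval (mconst :: 'a \<Rightarrow> (5, 'a) mpol) x) y)" for x y
    by (intro peval_hom mconst_hom)
  have p3: "unital_hom (peval (peval (peval (mconst :: 'a \<Rightarrow> (5, 'a) mpol) x) y) z)" for x y z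
    by (intro peval_hom mconst_hom)
  note ps = peval_pCons[OF mconst_hom] peval_pCons[OF p1] peval_pCons[OF p2] peval_pCons[OF p3]
    peval_0 unital_hom_simps[OF mconst_hom] unital_hom_simps[OF p1] unital_hom_simps[OF p2] unital_hom_simps[OF p3]
  show "theta (hV x) = mconst x" "theta [:[:aZ:]:] = mvar 1 + mvar 2" "theta [:[:bZ:]:] = mvar 3 + mvar 4"
  "theta [:uW:] = mvar 1" "theta vV = mvar 3"
    by (simp_all add: theta_def hV_def aZ_def bZ_def uW_def vV_def ps)
qed

private lemma phiV_vals: "phiV (hV x) = embed_const x" "phiV [:[:aZ:]:] = par_a" "phiV [:[:bZ:]:] = par_b"
  "phiV [:uW:] = point_x1 y1 y3" "phiV vV = point_x3 y2 y3" and phiV_const: "phiV [:w:] = peval coef_hom (point_x1 y1 y3) w"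
proof -
  note ps = peval_pCons[OF homs(4)] peval_pCons[OF coef_hom_hom] peval_0 unital_hom_simps[OF homs(4)]
     unital_hom_simps[OF coef_hom_hom]
  have k: "unital_hom (peval embed_const par_a :: 'a poly \<Rightarrow> 'a genfield)"
    by (rule peval_hom[OF embed_const_hom])
  have c: "coef_hom [:[:x:]:] = embed_const x" "coef_hom aZ = par_a" "coef_hom bZ = par_b" for x :: 'a
    by (simp_all add: coef_hom_def aZ_def bZ_def peval_pCons[OF k] peval_pCons[OF embed_const_hom] peval_0
      unital_hom_simps[OF embed_const_hom] unital_hom_simps[OF k])
  show "phiV (hV x) = embed_const x" "phiV [:[:aZ:]:] = par_a" "phiV [:[:bZ:]:] = par_b"
    "phiV [:uW:] = point_x1 y1 y3" "phiV vV = point_x3 y2 y3" and phiV_const: "phiV [:w:] = peval coef_hom (point_x1 y1 y3) w"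
    by (simp_all add: phiV_def hV_def uW_def vV_def ps c)
qed

private lemma eval_generic_factor: "eval_generic y1 y2 y3 p = phiV (psi p)"
proof (rule mpol_hom_eqI[OF eval_generic_hom unital_hom_compose[OF homs(3,1)]])
  show "eval_generic y1 y2 y3 (mconst x) = phiV (psi (mconst x))" for x
    by (simp add: eval_generic_def psi_def mev_const embed_const_hom hV_hom phiV_vals)
  show "eval_generic y1 y2 y3 (mvar i) = phiV (psi (mvar i))" for i
    using index5_cases[of i] unfolding insert_iff empty_iff
    by (elim disjE FalseE) (simp_all only: eval_generic_def psi_def mev_var[OF embed_const_hom] mev_var[OF hV_hom]
        coords_simps unital_hom_simps[OF homs(3)] phiV_vals)
qed

private lemma gens_mem: "theta FV \<in> curve_ideal A B" "theta GV \<in> curve_ideal A B" "theta [:HW:] \<in> curve_ideal A B"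
  "phiV FV = 0" "phiV [:HW:] = 0"
proof -
  have retr: "theta (psi p) - p \<in> curve_ideal A B" for p
    unfolding psi_def by (rule coords_retract[OF hV_hom homs(2) two theta_vals])
  have g: "psi (gen2 A) = FV" "psi (gen3 A B) = GV"
    unfolding psi_def FV_def GV_def using mev_gens[OF hV_hom two l(1)] by blast+
  show F: "theta FV \<in> curve_ideal A B" and G: "theta GV \<in> curve_ideal A B"
    using retract_mem[OF retr] curve_ideal_closed(8,9) unfolding g[symmetric] by blast+
  then show "theta [:HW:] \<in> curve_ideal A B"
    unfolding HW_eq unital_hom_simps[OF homs(2)] by (intro curve_ideal_closed(2,3))
  have pF: "phiV FV = 0" and pG: "phiV GV = 0"
    unfolding FV_def GV_def cubic_hom[OF homs(3)] quartic_hom[OF homs(3)] phiV_vals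
    by (rule point_on_curve[OF two l y])+
  then show "phiV FV = 0" "phiV [:HW:] = 0"
    unfolding HW_eq unital_hom_simps[OF homs(3)] by simp_all
qed

text \<open>Two pseudo-divisions, by \<open>FV\<close> in \<open>x\<^sub>3\<close> with leading coefficient \<open>b\<close> and by \<open>HW\<close> in \<open>x\<^sub>1\<close> with leading coefficient \<open>a\<close>, reduce
  a polynomial vanishing at the point to a combination of eight monomials, which must be zero by
  independence. The factors \<open>a\<close> and \<open>b\<close> introduced by the divisions are then cancelled modulo the ideal.\<close>

lemma eval_generic_kernel: "eval_generic y1 y2 y3 p = 0 \<longleftrightarrow> p \<in> curve_ideal A B"
proof
  show "eval_generic y1 y2 y3 p = 0" if "p \<in> curve_ideal A B"
    using eval_generic_zero_on_ideal[OF two l y that] .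
next
  assume "eval_generic y1 y2 y3 p = 0"
  then have p0: "phiV (psi p) = 0"
    by (simp add: eval_generic_factor)
  define \<alpha> \<beta> where "\<alpha> = [:[:aZ:]:]" and "\<beta> = [:[:bZ:]:]"
  note T = unital_hom_simps[OF homs(2)] and P = unital_hom_simps[OF homs(3)] and L = unital_hom_simps[OF lift_hom(2)]
  obtain n q r where nq: "smult (lead_coeff FV ^ n) (psi p) = FV * q + r" "r = 0 \<or> degree r < degree FV"
    by (rule pseudo_division[OF FV_lead(1)])
  obtain r0 r1 where r: "r = [:r0, r1:]"
    using degree_less_2_expand[of r] nq(2) FV_lead(2) by metis
  obtain m0 q0 s0 where s0: "smult (lead_coeff HW ^ m0) r0 = HW * q0 + s0" "s0 = 0 \<or> degree s0 < degree HW"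
    by (rule pseudo_division[OF HW_lead(1)])
  obtain m1 q1 s1 where s1: "smult (lead_coeff HW ^ m1) r1 = HW * q1 + s1" "s1 = 0 \<or> degree s1 < degree HW"
    by (rule pseudo_division[OF HW_lead(1)])
  have n: "\<beta> ^ n * psi p = FV * q + ([:r0:] + [:r1:] * vV)"
  proof -
    have "\<beta> ^ n = [:lead_coeff FV ^ n:]"
      unfolding FV_lead(3) \<beta>_def by (simp only: L)
    moreover have "[:r0, r1:] = [:r0:] + [:r1:] * vV"
      by (simp add: vV_def)
    ultimately show ?thesis
      using nq(1) r by simp
  qed
  have m: "\<alpha> ^ k * [:w:] = [:HW:] * [:q':] + [:s:]" if "smult (lead_coeff HW ^ k) w = HW * q' + s" for k w q' s
  proof -
    have "\<alpha> ^ k = [:[:aZ ^ k:]:]"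
      unfolding \<alpha>_def by (simp only: unital_hom_simps[OF lift_hom(1)])
    then have "\<alpha> ^ k * [:w:] = [:smult (lead_coeff HW ^ k) w:]"
      unfolding HW_lead(3) by simp
    then show ?thesis
      unfolding that by simp
  qed
  note n0 = m[OF s0(1)] and n1 = m[OF s1(1)]
  have main: "\<alpha> ^ (m0 + m1) * \<beta> ^ n * psi p = \<alpha> ^ (m0 + m1) * q * FV + (\<alpha> ^ m1 * [:q0:] + \<alpha> ^ m0 * [:q1:] * vV) * [:HW:]
      + (\<alpha> ^ m1 * [:s0:] + \<alpha> ^ m0 * [:s1:] * vV)"
  proof -
    have "\<alpha> ^ (m0 + m1) * \<beta> ^ n * psi p = \<alpha> ^ (m0 + m1) * (FV * q + ([:r0:] + [:r1:] * vV))"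
      by (simp only: mult.assoc n)
    also have "\<dots> = \<alpha> ^ (m0 + m1) * q * FV + \<alpha> ^ m1 * (\<alpha> ^ m0 * [:r0:]) + \<alpha> ^ m0 * (\<alpha> ^ m1 * [:r1:]) * vV"
      by (simp only: power_add algebra_simps)
    also have "\<dots> = \<alpha> ^ (m0 + m1) * q * FV + (\<alpha> ^ m1 * [:q0:] + \<alpha> ^ m0 * [:q1:] * vV) * [:HW:]
      + (\<alpha> ^ m1 * [:s0:] + \<alpha> ^ m0 * [:s1:] * vV)"
      unfolding n0 n1 by (simp only: algebra_simps)
    finally show ?thesis .
  qed
  let ?S0 = "peval coef_hom (point_x1 y1 y3) s0" and ?S1 = "peval coef_hom (point_x1 y1 y3) s1"
  have ph: "phiV (\<alpha> ^ (m0 + m1) * \<beta> ^ n * psi p) = par_a ^ m1 * ?S0 + par_a ^ m0 * ?S1 * point_x3 y2 y3"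
    unfolding main P gens_mem by (simp only: \<alpha>_def phiV_vals P mult_zero_right add_0) (simp only: phiV_const)
  have "par_a ^ m1 * ?S0 + par_a ^ m0 * ?S1 * point_x3 y2 y3 = 0"
    unfolding ph[symmetric] P p0 by simp
  moreover have t: "subfield_set (adjoin (adjoin base y1) y3)" and t1: "subfield_set (adjoin base y1)"
    by (rule tower2_subfield_set[OF two l(2) y] tower1_subfield_set[OF two l(2) y])+
  have "par_a \<in> adjoin (adjoin base y1) y3"
    by (rule adjoin_mem(2)[OF t1 adjoin_mem(2)[OF base_subfield_set parameters_in_base(1)]])
  then have "par_a ^ k * peval coef_hom (point_x1 y1 y3) s \<in> adjoin (adjoin base y1) y3" for k s
    by (intro subfield_set_closed(5,9)[OF t] peval_X1_tower[OF two l y])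
  ultimately have "par_a ^ m1 * ?S0 = 0 \<and> par_a ^ m0 * ?S1 = 0"
    by (intro adjoin_independent[OF t point_x3_tower[OF two l y]])
  then have "?S0 = 0" "?S1 = 0"
    using parameters_nonzero(1)[where 'a = 'a] by auto
  then have "s0 = 0" "s1 = 0"
    using eval_low_degree_eq_0[OF two l y] s0(2) s1(2) HW_lead(2) by auto
  then have "theta (\<alpha> ^ (m0 + m1) * \<beta> ^ n * psi p) \<in> curve_ideal A B"
    unfolding main T by (simp add: T) (intro curve_ideal_closed(2,3) gens_mem)
  then have "(mvar 1 + mvar 2) ^ (m0 + m1) * ((mvar 3 + mvar 4) ^ n * theta (psi p)) \<in> curve_ideal A B"
    by (simp only: T \<alpha>_def \<beta>_def theta_vals mult.assoc)
  moreover have "f \<in> curve_ideal A B" if "(mvar 1 + mvar 2) ^ k * f \<in> curve_ideal A B" for k f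
    using that by (induction k) (auto simp: mult.assoc dest: sum12_nonzerodivisor[OF two l])
  moreover have "f \<in> curve_ideal A B" if "(mvar 3 + mvar 4) ^ k * f \<in> curve_ideal A B" for k f
    using that by (induction k) (auto simp: mult.assoc dest: sum34_nonzerodivisor[OF two l])
  ultimately have "theta (psi p) \<in> curve_ideal A B"
    by blast
  moreover have "theta (psi p) - p \<in> curve_ideal A B"
    unfolding psi_def by (rule coords_retract[OF hV_hom homs(2) two theta_vals])
  ultimately show "p \<in> curve_ideal A B"
    using retract_mem by blast
qed

lemma curve_ideal_prime: "primeideal (curve_ideal A B) mpol_ring"
proof (rule primeidealI)
  show "ideal (curve_ideal A B) mpol_ring"
    by (rule curve_ideal_is_ideal)
  show "cring (mpol_ring :: (5, 'a) mpol ring)"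
    by (rule cring_from_type_algebra)
  note H = unital_hom_simps[OF eval_generic_hom[of y1 y2 y3]]
  have "1 \<notin> curve_ideal A B"
    by (simp add: H flip: eval_generic_kernel)
  then show "carrier mpol_ring \<noteq> curve_ideal A B"
    by (auto simp: ring_of_type_algebra_def)
  show "p \<in> curve_ideal A B \<or> q \<in> curve_ideal A B"
    if "p \<otimes>\<^bsub>mpol_ring\<^esub> q \<in> curve_ideal A B" for p q
    using that by (simp add: ring_of_type_algebra_def H flip: eval_generic_kernel)
qed

end

section \<open>Transfer along an embedding into a field\<close>

text \<open>A field given by a carrier set, embedded in a field given as a type: equations and non-membership are
  verified on the image.\<close>

locale field_embedding = field R for R :: "('b, 'c) ring_scheme" (structure) +
  fixes T :: "'b \<Rightarrow> 'f::Fields.field"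
  assumes T_add: "x \<in> carrier R \<Longrightarrow> y \<in> carrier R \<Longrightarrow> T (x \<oplus> y) = T x + T y"
    and T_mult: "x \<in> carrier R \<Longrightarrow> y \<in> carrier R \<Longrightarrow> T (x \<otimes> y) = T x * T y"
    and T_one: "T \<one> = 1"
    and T_inj: "inj_on T (carrier R)"
begin

lemma T_zero: "T \<zero> = 0"
  using T_add[of \<zero> \<zero>] by (metis add_cancel_left_right l_zero zero_closed)

lemma T_eq_iff: "x \<in> carrier R \<Longrightarrow> y \<in> carrier R \<Longrightarrow> T x = T y \<longleftrightarrow> x = y"
  using T_inj by (auto dest: inj_onD)

lemma T_eq_0_iff: "x \<in> carrier R \<Longrightarrow> T x = 0 \<longleftrightarrow> x = \<zero>"
  using T_eq_iff[of x \<zero>] by (simp add: T_zero)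

lemma T_neg: "x \<in> carrier R \<Longrightarrow> T (\<ominus> x) = - T x"
  using T_add[of x "\<ominus> x"] by (simp add: r_neg T_zero eq_neg_iff_add_eq_0 add.commute)

lemma nonzero_inv_closed: "x \<in> carrier R \<Longrightarrow> x \<noteq> \<zero> \<Longrightarrow> inv x \<in> carrier R"
  using field_Units by auto

lemma T_inv:
  assumes "x \<in> carrier R" "x \<noteq> \<zero>"
  shows "T (inv x) = inverse (T x)"
proof -
  have "T x * T (inv x) = 1"
    using assms nonzero_inv_closed[OF assms] by (simp add: field_Units T_one flip: T_mult)
  then show ?thesis
    by (metis inverse_unique)
qed

lemma T_pow: "x \<in> carrier R \<Longrightarrow> T (x [^] (n::nat)) = T x ^ n"
  by (induction n) (simp_all add: T_one T_mult)

lemma image_generate_field: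
  assumes "H \<subseteq> carrier R" "T ` H \<subseteq> S" "subfield_set S"
  shows "T ` generate_field R H \<subseteq> S"
proof
  note c = subfield_set_closed[OF assms(3)]
  have "T u \<in> S" if "u \<in> generate_field R H" for u
    using that
  proof induction
    case (m_inv h)
    then have "h \<in> carrier R"
      using generate_field_in_carrier[OF assms(1)] by blast
    with m_inv show ?case
      by (simp add: T_inv c)
  qed (use assms(2) generate_field_in_carrier[OF assms(1)] in \<open>auto simp: T_one T_neg T_add T_mult c\<close>)
  then show "v \<in> S" if "v \<in> T ` generate_field R H" for v
    using that by blast
qed

lemma image_subfield:
  assumes "subfield F R"
  shows "subfield_set (T ` F)"
  unfolding subfield_set_def
proof (intro conjI ballI)
  have F: "F \<subseteq> carrier R" and sr: "subring F R"
    using subfieldE[OF assms] by blast+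
  have "\<one> \<in> F"
    using subringE(3)[OF sr] .
  then show "1 \<in> T ` F"
    by (metis T_one image_eqI)
  fix p assume "p \<in> T ` F"
  then obtain u where u: "p = T u" "u \<in> F"
    by blast
  show "inverse p \<in> T ` F"
  proof (cases "u = \<zero>")
    case True
    then show ?thesis
      using u by (simp add: T_zero) (metis T_zero image_eqI)
  next
    case False
    then have "inv u \<in> F" "T (inv u) = inverse p"
      using subfield_m_inv(1)[OF assms, of u] u T_inv F by auto
    then show ?thesis
      by (metis image_eqI)
  qed
  fix q assume "q \<in> T ` F"
  then obtain v where v: "q = T v" "v \<in> F"
    by blast
  have "T (u \<oplus> (\<ominus> v)) = p - q" "T (u \<otimes> v) = p * q"
    using u v F by (simp_all add: T_add T_neg T_mult subset_iff)
  moreover have "u \<oplus> (\<ominus> v) \<in> F" "u \<otimes> v \<in> F"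
    using subringE(5,6,7)[OF sr] u v by auto
  ultimately show "p - q \<in> T ` F" "p * q \<in> T ` F"
    by (metis image_eqI)+
qed

lemma subfield_from_image:
  assumes "F \<subseteq> carrier R" "subfield_set (T ` F)"
  shows "subfield F R"
proof -
  note c = subfield_set_closed[OF assms(2)]
  have m: "u \<in> F" if "u \<in> carrier R" "T u \<in> T ` F" for u
    using that assms(1) T_inj by (auto simp: inj_on_def subset_iff)
  have k: "u \<in> carrier R" if "u \<in> F" for u
    using that assms(1) by blast
  show ?thesis
  proof (rule subfieldI')
    show "subring F R"
    proof (rule subringI[OF assms(1)])
      show "\<one> \<in> F"
        by (rule m) (simp_all add: T_one c)
      show "\<ominus> u \<in> F" if "u \<in> F" for u
        by (rule m) (use that k in \<open>simp_all add: T_neg c\<close>)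
      show "u \<otimes> v \<in> F" if "u \<in> F" "v \<in> F" for u v
        by (rule m) (use that k in \<open>simp_all add: T_mult c\<close>)
      show "u \<oplus> v \<in> F" if "u \<in> F" "v \<in> F" for u v
        by (rule m) (use that k in \<open>simp_all add: T_add c\<close>)
    qed
    show "inv u \<in> F" if "u \<in> F - {\<zero>}" for u
      by (rule m) (use that k in \<open>simp_all add: T_inv c nonzero_inv_closed\<close>)
  qed
qed

text \<open>The span of \<open>y\<close> and \<open>1\<close> is all of the generated field because its image is \<open>adjoin (T ` F) (T y)\<close>, which is
  closed under inversion.\<close>

lemma artin_schreier_dimension:
  assumes two: "(2::'f) = 0" and F: "subfield F R" and y: "y \<in> carrier R" "y \<notin> F" "T y ^ 2 + T y \<in> T ` F"
  shows "dimension 2 F (generate_field R (F \<union> {y}))"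
proof -
  have Fc: "F \<subseteq> carrier R" and sr: "subring F R"
    using subfieldE[OF F] by blast+
  have H: "F \<union> {y} \<subseteq> carrier R"
    using Fc y by auto
  have F0: "\<zero> \<in> F" and F1: "\<one> \<in> F"
    using subringE(2,3)[OF sr] .
  have S1: "Span F [\<one>] = F"
  proof (intro subset_antisym subsetI)
    fix u assume "u \<in> Span F [\<one>]"
    then obtain Ks where Ks: "set Ks \<subseteq> F" "length Ks = length [\<one>]" "u = combine Ks [\<one>]"
      using Span_mem_iff_length_version[OF F, of "[\<one>]" u] by auto
    then obtain k where "Ks = [k]"
      by (auto simp: length_Suc_conv)
    then show "u \<in> F"
      using Ks Fc by (auto simp: subset_iff)
  next
    fix u assume u: "u \<in> F"
    then have "u = combine [u] [\<one>]"
      using Fc by (auto simp: subset_iff)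
    then show "u \<in> Span F [\<one>]"
      using Span_mem_iff_length_version[OF F, of "[\<one>]" u] u
      by (metis empty_subsetI empty_set insert_subset length_Cons list.simps(15) one_closed)
  qed
  have "independent F [\<one>]"
    by (intro li_Cons) simp_all
  moreover have "y \<notin> Span F [\<one>]"
    unfolding S1 by (rule y(2))
  ultimately have "independent F [y, \<one>]"
    using y(1) by (blast intro: li_Cons)
  from dimension_independent[OF this] have dim: "dimension 2 F (Span F [y, \<one>])"
    by (simp add: numeral_2_eq_2)
  have Sp: "u \<in> Span F [y, \<one>] \<longleftrightarrow> (\<exists>a\<in>F. \<exists>b\<in>F. u = a \<otimes> y \<oplus> b)" for u
  proof -
    have "u \<in> Span F [y, \<one>] \<longleftrightarrow> (\<exists>Ks. set Ks \<subseteq> F \<and> length Ks = 2 \<and> u = combine Ks [y, \<one>])"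
      using Span_mem_iff_length_version[OF F, of "[y, \<one>]" u] y by (simp add: numeral_2_eq_2)
    also have "\<dots> \<longleftrightarrow> (\<exists>a\<in>F. \<exists>b\<in>F. u = combine [a, b] [y, \<one>])"
    proof
      assume "\<exists>Ks. set Ks \<subseteq> F \<and> length Ks = 2 \<and> u = combine Ks [y, \<one>]"
      then obtain Ks where Ks: "set Ks \<subseteq> F" "length Ks = 2" "u = combine Ks [y, \<one>]"
        by blast
      then obtain a b where "Ks = [a, b]"
        by (auto simp: length_Suc_conv numeral_2_eq_2)
      with Ks show "\<exists>a\<in>F. \<exists>b\<in>F. u = combine [a, b] [y, \<one>]"
        by auto
    next
      assume "\<exists>a\<in>F. \<exists>b\<in>F. u = combine [a, b] [y, \<one>]"
      then obtain a b where "a \<in> F" "b \<in> F" "u = combine [a, b] [y, \<one>]"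
        by blast
      then show "\<exists>Ks. set Ks \<subseteq> F \<and> length Ks = 2 \<and> u = combine Ks [y, \<one>]"
        by (intro exI[of _ "[a, b]"]) simp
    qed
    finally show ?thesis
      using Fc by (auto simp: subset_iff)
  qed
  have "Span F [y, \<one>] = generate_field R (F \<union> {y})"
  proof (intro subset_antisym subsetI)
    fix u assume "u \<in> Span F [y, \<one>]"
    then show "u \<in> generate_field R (F \<union> {y})"
      unfolding Sp by (auto intro!: generate_field.eng_add generate_field.eng_mult intro: generate_field.incl)
  next
    fix u assume u: "u \<in> generate_field R (F \<union> {y})"
    have sF: "subfield_set (T ` F)"
      by (rule image_subfield[OF F])
    have "T ` (F \<union> {y}) \<subseteq> adjoin (T ` F) (T y)"
      using adjoin_mem[OF sF] by blast
    from image_generate_field[OF H this subfield_set_adjoin[OF two sF y(3)]] u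
    obtain a b where ab: "a \<in> F" "b \<in> F" "T u = T b + T a * T y"
      by (auto simp: adjoin_def image_subset_iff)
    have c: "a \<in> carrier R" "b \<in> carrier R"
      using ab Fc by auto
    have "T u = T (a \<otimes> y \<oplus> b)"
      using ab c y by (simp add: T_add T_mult add.commute)
    then have "u = a \<otimes> y \<oplus> b"
      using T_eq_iff[of u "a \<otimes> y \<oplus> b"] c y generate_field_in_carrier[OF H u] by simp
    then show "u \<in> Span F [y, \<one>]"
      unfolding Sp using ab by blast
  qed
  with dim show ?thesis
    by simp
qed

end

text \<open>Every field axiom is an equation, or the existence of an inverse, that can be checked on images under the
  injective map \<open>T\<close>.\<close>

lemma field_by_embedding:
  fixes R :: "('b, 'c) ring_scheme" (structure) and T :: "'b \<Rightarrow> 'f::Fields.field"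
  assumes cl: "\<And>x y. x \<in> carrier R \<Longrightarrow> y \<in> carrier R \<Longrightarrow> x \<oplus> y \<in> carrier R"
      "\<And>x y. x \<in> carrier R \<Longrightarrow> y \<in> carrier R \<Longrightarrow> x \<otimes> y \<in> carrier R"
      "\<zero> \<in> carrier R" "\<one> \<in> carrier R"
    and T: "\<And>x y. x \<in> carrier R \<Longrightarrow> y \<in> carrier R \<Longrightarrow> T (x \<oplus> y) = T x + T y"
      "\<And>x y. x \<in> carrier R \<Longrightarrow> y \<in> carrier R \<Longrightarrow> T (x \<otimes> y) = T x * T y"
      "T \<zero> = 0" "T \<one> = 1"
    and inj: "inj_on T (carrier R)"
    and neg: "\<And>x. x \<in> carrier R \<Longrightarrow> \<exists>y\<in>carrier R. T y = - T x"
    and inv: "\<And>x. x \<in> carrier R \<Longrightarrow> T x \<noteq> 0 \<Longrightarrow> \<exists>y\<in>carrier R. T y = inverse (T x)"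
  shows "field_embedding R T"
proof -
  have eq: "x = y" if "T x = T y" "x \<in> carrier R" "y \<in> carrier R" for x y
    using inj that by (auto dest: inj_onD)
  have "cring R"
  proof (rule cringI)
    show "abelian_group R"
    proof (rule abelian_groupI)
      fix x assume x: "x \<in> carrier R"
      then obtain y where "y \<in> carrier R" "T y = - T x"
        using neg by blast
      then show "\<exists>y\<in>carrier R. y \<oplus> x = \<zero>"
        using x by (intro bexI[of _ y] eq) (simp_all add: cl T)
    qed (auto intro!: eq simp: cl T)
    show "comm_monoid R"
      by (rule comm_monoidI) (auto intro!: eq simp: cl T)
  qed (auto intro!: eq simp: cl T algebra_simps)
  then interpret cring R .
  have "field R"
  proof (rule cring_fieldI2)
    show "\<zero> \<noteq> \<one>"
      using T(3,4) by (metis zero_neq_one)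
    fix x assume x: "x \<in> carrier R" "x \<noteq> \<zero>"
    then have nz: "T x \<noteq> 0"
      using eq[of x \<zero>] by (auto simp: T cl)
    then obtain y where "y \<in> carrier R" "T y = inverse (T x)"
      using inv x by blast
    then show "\<exists>y\<in>carrier R. x \<otimes> y = \<one>"
      using x nz by (intro bexI[of _ y] eq) (simp_all add: T)
  qed
  then show ?thesis
    by (intro field_embedding.intro field_embedding_axioms.intro) (auto simp: T inj)
qed


section \<open>The function field as a field of values\<close>

lemma homogeneous_add: "homogeneous d f \<Longrightarrow> homogeneous d g \<Longrightarrow> homogeneous d (f + g)"
  using keys_add[of f g] by (auto simp: homogeneous_def)

lemma homogeneous_mult:
  assumes "homogeneous d f" "homogeneous e g"
  shows "homogeneous (d + e) (f * g)"
  unfolding homogeneous_def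
proof
  fix k assume "k \<in> Poly_Mapping.keys (f * g)"
  then obtain a b where "k = a + b" "a \<in> Poly_Mapping.keys f" "b \<in> Poly_Mapping.keys g"
    using keys_mult[of f g] by blast
  then show "(\<Sum>i\<in>UNIV. Poly_Mapping.lookup k i) = d + e"
    using assms by (simp add: homogeneous_def lookup_add sum.distrib)
qed

lemma homogeneous_const: "homogeneous 0 (mconst c)"
  by (simp add: homogeneous_def mconst_def)

lemma homogeneous_var: "homogeneous 1 (mvar i)"
  by (simp add: homogeneous_def mvar_def lookup_single when_def)

lemma homogeneous_1: "homogeneous 0 1"
  using homogeneous_const[of 1] by (simp add: unital_hom_simps[OF mconst_hom])

lemma mev_scale:
  assumes "homogeneous d f"
  shows "mev h (\<lambda>i. t * v i) f = t ^ d * mev h v f"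
proof -
  have "(\<Prod>i\<in>UNIV. (t * v i) ^ Poly_Mapping.lookup e i) = t ^ d * (\<Prod>i\<in>UNIV. v i ^ Poly_Mapping.lookup e i)"
    if "e \<in> Poly_Mapping.keys f" for e
    using that assms by (simp add: homogeneous_def power_mult_distrib prod.distrib flip: power_sum)
  then show ?thesis
    unfolding mev_def sum_distrib_left by (intro sum.cong) (simp_all add: algebra_simps)
qed

lemma mev_in_subfield:
  assumes S: "subfield_set S" and h: "unital_hom h" "\<And>c. h c \<in> S" and v: "\<And>i. v i \<in> S"
  shows "mev h v f \<in> S"
  by (induction f rule: mpol_induct)
    (simp_all add: mev_const mev_var h v subfield_set_closed[OF S] unital_hom_simps[OF mev_hom[OF h(1)]])

text \<open>When \<open>I\<close> is the kernel of a homomorphism \<open>\<phi>\<close> into a field, the class of \<open>f/g\<close> is determined by its value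
  \<open>\<phi> f / \<phi> g\<close>. All structure of the function field is read off from values.\<close>

locale value_field =
  fixes \<phi> :: "('n::finite, 'a::Fields.field) mpol \<Rightarrow> 'f::Fields.field" and I
  assumes hom: "unital_hom \<phi>" and I: "I = {p. \<phi> p = 0}"
begin

abbreviation "K \<equiv> function_field I"

definition val :: "(('n, 'a) mpol \<times> ('n, 'a) mpol) set \<Rightarrow> 'f" where
  "val u = (THE z. \<forall>p\<in>u. z = \<phi> (fst p) / \<phi> (snd p))"

lemmas H = unital_hom_simps[OF hom]

lemma mem_iff: "p \<in> I \<longleftrightarrow> \<phi> p = 0"
  by (simp add: I)

lemma pairs_iff: "(f, g) \<in> frac_pairs I \<longleftrightarrow> \<phi> g \<noteq> 0 \<and> (\<exists>d. homogeneous d f \<and> homogeneous d g)"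
  by (simp add: frac_pairs_def mem_iff)

lemma rel_iff: "((f, g), (f', g')) \<in> frac_rel I \<longleftrightarrow>
  (f, g) \<in> frac_pairs I \<and> (f', g') \<in> frac_pairs I \<and> \<phi> f / \<phi> g = \<phi> f' / \<phi> g'"
  by (auto simp: frac_rel_def pairs_iff mem_iff H frac_eq_eq)

lemma frac_mem: "(f, g) \<in> frac_pairs I \<Longrightarrow> p \<in> frac I f g \<longleftrightarrow> p \<in> frac_pairs I \<and> \<phi> (fst p) / \<phi> (snd p) = \<phi> f / \<phi> g"
  by (cases p) (auto simp: frac_def rel_iff)

lemma frac_self: "(f, g) \<in> frac_pairs I \<Longrightarrow> (f, g) \<in> frac I f g"
  by (simp add: frac_mem)

lemma val_frac: "(f, g) \<in> frac_pairs I \<Longrightarrow> val (frac I f g) = \<phi> f / \<phi> g"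
  unfolding val_def using frac_self[of f g] by (intro the_equality) (auto simp: frac_mem)

lemma frac_eq: 
  assumes "(f, g) \<in> frac_pairs I" "(f', g') \<in> frac_pairs I" "\<phi> f / \<phi> g = \<phi> f' / \<phi> g'"
  shows "frac I f g = frac I f' g'"
  using assms by (auto simp: frac_mem)

lemma carrier_K: "carrier K = {frac I f g | f g. (f, g) \<in> frac_pairs I}"
  by (auto simp: function_field_def quotient_def frac_def)

lemma carrierE:
  assumes "u \<in> carrier K"
  obtains f g where "u = frac I f g" "(f, g) \<in> frac_pairs I"
  using assms unfolding carrier_K by blast

lemma frac_carrier: "(f, g) \<in> frac_pairs I \<Longrightarrow> frac I f g \<in> carrier K"
  unfolding carrier_K by blast

lemma pairs_closed:
  assumes "(f, g) \<in> frac_pairs I" "(f', g') \<in> frac_pairs I"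
  shows "(f * f', g * g') \<in> frac_pairs I" "(f * g' + f' * g, g * g') \<in> frac_pairs I"
proof -
  obtain d e where d: "homogeneous d f" "homogeneous d g" "homogeneous e f'" "homogeneous e g'" "\<phi> g \<noteq> 0" "\<phi> g' \<noteq> 0"
    using assms unfolding pairs_iff by blast
  then have "homogeneous (d + e) (f * f')" "homogeneous (d + e) (g * g')" "homogeneous (d + e) (f * g')"
     "homogeneous (d + e) (f' * g)"
    using homogeneous_mult[of e f' d g] by (simp_all add: homogeneous_mult add.commute)
  then show "(f * f', g * g') \<in> frac_pairs I" "(f * g' + f' * g, g * g') \<in> frac_pairs I"
    using d by (auto simp: pairs_iff H intro: homogeneous_add)
qed

lemma mult_frac:
  assumes p: "(f, g) \<in> frac_pairs I" "(f', g') \<in> frac_pairs I"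
  shows "frac I f g \<otimes>\<^bsub>K\<^esub> frac I f' g' = frac I (f * f') (g * g')"
proof -
  have "frac I (fst p * fst q) (snd p * snd q) = frac I (f * f') (g * g')"
    if "p \<in> frac I f g" "q \<in> frac I f' g'" for p q
  proof (rule frac_eq)
    show "(fst p * fst q, snd p * snd q) \<in> frac_pairs I"
      using that p by (intro pairs_closed) (simp_all add: frac_mem)
    show "(f * f', g * g') \<in> frac_pairs I"
      by (intro pairs_closed p)
    show "\<phi> (fst p * fst q) / \<phi> (snd p * snd q) = \<phi> (f * f') / \<phi> (g * g')"
    proof -
      have "\<phi> (fst p) / \<phi> (snd p) = \<phi> f / \<phi> g" "\<phi> (fst q) / \<phi> (snd q) = \<phi> f' / \<phi> g'"
        using that p by (simp_all add: frac_mem)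
      then show ?thesis
        unfolding H times_divide_times_eq[symmetric] by (simp only:)
    qed
  qed
  then show ?thesis
    using frac_self[OF p(1)] frac_self[OF p(2)] by (auto simp: function_field_def)
qed

lemma add_frac:
  assumes p: "(f, g) \<in> frac_pairs I" "(f', g') \<in> frac_pairs I"
  shows "frac I f g \<oplus>\<^bsub>K\<^esub> frac I f' g' = frac I (f * g' + f' * g) (g * g')"
proof -
  have quot: "\<phi> (a * b' + a' * b) / \<phi> (b * b') = \<phi> a / \<phi> b + \<phi> a' / \<phi> b'"
    if "\<phi> b \<noteq> 0" "\<phi> b' \<noteq> 0" for a b a' b'
    using that by (simp add: H add_frac_eq)
  have "frac I (fst p * snd q + fst q * snd p) (snd p * snd q) = frac I (f * g' + f' * g) (g * g')"
    if "p \<in> frac I f g" "q \<in> frac I f' g'" for p q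
  proof (rule frac_eq)
    have m: "(fst p, snd p) \<in> frac_pairs I" "(fst q, snd q) \<in> frac_pairs I"
      using that p by (simp_all add: frac_mem)
    then show "(fst p * snd q + fst q * snd p, snd p * snd q) \<in> frac_pairs I"
      by (rule pairs_closed)
    show "(f * g' + f' * g, g * g') \<in> frac_pairs I"
      by (intro pairs_closed p)
    show "\<phi> (fst p * snd q + fst q * snd p) / \<phi> (snd p * snd q) = \<phi> (f * g' + f' * g) / \<phi> (g * g')"
    proof -
      have nz: "\<phi> (snd p) \<noteq> 0" "\<phi> (snd q) \<noteq> 0" "\<phi> g \<noteq> 0" "\<phi> g' \<noteq> 0"
        using m p unfolding pairs_iff by blast+
      show ?thesis
        unfolding quot[OF nz(1,2)] quot[OF nz(3,4)] using that p by (simp add: frac_mem)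
    qed
  qed
  then show ?thesis
    using frac_self[OF p(1)] frac_self[OF p(2)] by (auto simp: function_field_def)
qed

lemma pairs_const: "(mconst c, 1) \<in> frac_pairs I"
  using homogeneous_const homogeneous_1 by (auto simp: pairs_iff H)

lemma pairs_0: "(0, 1) \<in> frac_pairs I" and pairs_1: "(1, 1) \<in> frac_pairs I"
  using pairs_const[of 0] pairs_const[of 1] by (simp_all add: unital_hom_simps[OF mconst_hom])

lemma zero_K: "\<zero>\<^bsub>K\<^esub> = frac I 0 1" and one_K: "\<one>\<^bsub>K\<^esub> = frac I 1 1"
  by (simp_all add: function_field_def)

lemma embedding: "field_embedding K val"
proof (rule field_by_embedding)
  show "inj_on val (carrier K)"
    by (rule inj_onI) (metis carrierE val_frac frac_eq)
  fix x y assume "x \<in> carrier K" "y \<in> carrier K"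
  then obtain f g f' g' where p: "x = frac I f g" "(f, g) \<in> frac_pairs I" "y = frac I f' g'" "(f', g') \<in> frac_pairs I"
    by (metis carrierE)
  show "x \<oplus>\<^bsub>K\<^esub> y \<in> carrier K" "x \<otimes>\<^bsub>K\<^esub> y \<in> carrier K"
    using p by (simp_all add: add_frac mult_frac frac_carrier pairs_closed)
  show "val (x \<otimes>\<^bsub>K\<^esub> y) = val x * val y"
    using p by (simp add: mult_frac val_frac pairs_closed H)
  show "val (x \<oplus>\<^bsub>K\<^esub> y) = val x + val y"
    using p by (simp add: add_frac val_frac pairs_closed H) (simp add: pairs_iff add_frac_eq)
next
  show "\<zero>\<^bsub>K\<^esub> \<in> carrier K" "\<one>\<^bsub>K\<^esub> \<in> carrier K" "val \<zero>\<^bsub>K\<^esub> = 0" "val \<one>\<^bsub>K\<^esub> = 1"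
    by (simp_all add: zero_K one_K frac_carrier pairs_0 pairs_1 val_frac H)
  fix x assume "x \<in> carrier K"
  then obtain f g where p: "x = frac I f g" "(f, g) \<in> frac_pairs I"
    by (metis carrierE)
  have "(mconst (-1) * f, 1 * g) \<in> frac_pairs I"
    by (intro pairs_closed pairs_const p)
  moreover have "\<phi> (mconst (-1)) = - 1"
    by (simp add: unital_hom_simps[OF mconst_hom] H)
  ultimately show "\<exists>y\<in>carrier K. val y = - val x"
    using p by (intro bexI[of _ "frac I (mconst (-1) * f) (1 * g)"] frac_carrier) (simp_all add: val_frac H)
  show "\<exists>y\<in>carrier K. val y = inverse (val x)" if "val x \<noteq> 0"
  proof -
    have "(g, f) \<in> frac_pairs I"
      using p that by (auto simp: val_frac pairs_iff)
    then show ?thesis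
      using p by (intro bexI[of _ "frac I g f"] frac_carrier) (simp_all add: val_frac)
  qed
qed

lemma val_const: "val (const_fn I c) = \<phi> (mconst c)" "const_fn I c \<in> carrier K"
  by (simp_all add: const_fn_def val_frac pairs_const frac_carrier H)

end

section \<open>The function field of the curve\<close>

text \<open>Over \<open>k(a)\<close> the quotient \<open>b / a\<close> is a nonconstant linear polynomial in \<open>b\<close>, and composing a nonzero polynomial
  with it gives a nonzero polynomial.\<close>

lemma ratio_transcendental:
  assumes "peval embed_const (par_b / par_a) P = 0"
  shows "P = (0 :: 'a::field poly)"
proof -
  define t where "t = to_fract [:0, 1::'a:]"
  define h where "h = (\<lambda>c::'a. to_fract [:c:])"
  define Q where "Q = [:0, inverse t:]"
  have t: "t \<noteq> 0"
    by (simp add: t_def)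
  have h: "unital_hom h"
    unfolding h_def by (intro unital_hom_compose[OF to_fract_hom] unital_hom_const_poly id_hom)
  have h0: "h c = 0 \<longleftrightarrow> c = 0" for c
    by (simp add: h_def)
  have "par_a * embed_poly Q = par_b"
    using t by (simp add: par_a_def par_b_def Q_def t_def[symmetric] flip: unital_hom_simps(3)[OF embed_poly_hom])
  then have x: "par_b / par_a = embed_poly Q"
    using parameters_nonzero(1)[where 'a = 'a] by (simp add: field_simps)
  have "peval embed_const (par_b / par_a) P = embed_poly (pcompose (map_poly h P) Q)"
  proof (induction P)
    case (pCons c P)
    have "map_poly h (pCons c P) = pCons (h c) (map_poly h P)"
      using h0[of 0] by (simp add: map_poly_pCons)
    then show ?case
      unfolding peval_pCons[OF embed_const_hom] pCons.IH
      by (simp add: x pcompose_pCons unital_hom_simps[OF embed_poly_hom] embed_const_def h_def)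
  qed (simp add: peval_0 unital_hom_simps[OF embed_poly_hom])
  then have "pcompose (map_poly h P) Q = 0"
    using assms by (simp add: embed_poly_eq_0_iff)
  then have "map_poly h P = 0"
    by (rule pcompose_eq_0) (simp add: Q_def t)
  then show ?thesis
    using h0 by (simp add: map_poly_eq_0_iff)
qed

lemma (in field_embedding) eval_as_peval:
  fixes k :: "'a::comm_ring_1 \<Rightarrow> 'b"
  assumes h: "unital_hom h" and k: "\<And>c. k c \<in> carrier R" "\<And>c. T (k c) = h c"
    and x: "x \<in> carrier R"
  shows "eval (map k cs) x \<in> carrier R \<and> T (eval (map k cs) x) = peval h (T x) (Poly (rev cs))"
proof (induction cs)
  case Nil
  then show ?case
    by (simp add: T_zero peval_0)
next
  case (Cons c cs)
  have "peval h (T x) (Polynomial.monom d n) = h d * T x ^ n" for d n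
    by (induction n) (simp_all add: monom_0 monom_Suc peval_pCons[OF h] peval_0 unital_hom_simps[OF h])
  then have "peval h (T x) (Poly (rev (c # cs))) = peval h (T x) (Poly (rev cs)) + h c * T x ^ length cs"
    by (simp add: Poly_snoc unital_hom_simps[OF peval_hom[OF h]])
  with Cons x k show ?case
    by (simp add: T_add T_mult T_pow add.commute)
qed

lemma homogeneous_quadratic: "homogeneous 1 f \<Longrightarrow> homogeneous 1 g \<Longrightarrow> homogeneous 2 (f * g)"
  using homogeneous_mult[of 1 f 1 g] by (simp add: numeral_2_eq_2)

lemma homogeneous_scalar: "homogeneous d f \<Longrightarrow> homogeneous d (mconst c * f)"
  using homogeneous_mult[OF homogeneous_const] by fastforce

definition sum12 :: "(5, 'a::field) mpol" where "sum12 = mvar 1 + mvar 2"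
definition sum34 :: "(5, 'a::field) mpol" where "sum34 = mvar 3 + mvar 4"
text \<open>The numerators of \<open>y\<^sub>1\<close> (for \<open>i = 1\<close>) and \<open>y\<^sub>2\<close> (for \<open>i = 3\<close>).\<close>

definition pair_form :: "'a::field \<Rightarrow> 5 \<Rightarrow> (5, 'a) mpol" where
  "pair_form c i = mvar i * mvar i + mvar i * mvar 0 + mconst c * (mvar 0 * mvar 0)"

lemma homogeneous_forms:
  "homogeneous 1 sum12" "homogeneous 1 sum34" "homogeneous 2 (pair_form c i)"
  "homogeneous 2 (sum12 * sum34)" "homogeneous 2 (sum34 * mvar 0)" "homogeneous 2 (mvar 1 * sum34 + pair_form c 1)"
proof -
  show s: "homogeneous 1 sum12" "homogeneous 1 sum34"
    unfolding sum12_def sum34_def by (intro homogeneous_add homogeneous_var)+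
  show n: "homogeneous 2 (pair_form c i)" for i
    unfolding pair_form_def by (intro homogeneous_add homogeneous_scalar homogeneous_quadratic homogeneous_var)
  show "homogeneous 2 (sum12 * sum34)" "homogeneous 2 (sum34 * mvar 0)" "homogeneous 2 (mvar 1 * sum34 + pair_form c 1)"
    by (intro homogeneous_add homogeneous_quadratic homogeneous_var s n)+
qed

context
  fixes A B l :: "'a::field" and w1 w2 w3 :: "'a genfield"
  assumes two: "(2::'a) = 0" and l: "l = B + A ^ 2 + A + 1" "l \<noteq> 0" and w: "generic_roots (A + 1) l w1 w2 w3"
begin

private lemma eval_generic_vals:
  "eval_generic w1 w2 w3 (mconst c) = embed_const c" "eval_generic w1 w2 w3 (mvar 0) = par_a + par_b" "eval_generic w1 w2 w3 (mvar 1) = point_x1 w1 w3"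
  "eval_generic w1 w2 w3 (mvar 2) = point_x1 w1 w3 + par_a" "eval_generic w1 w2 w3 (mvar 3) = point_x3 w2 w3"
  "eval_generic w1 w2 w3 (mvar 4) = point_x3 w2 w3 + par_b"
  by (simp_all add: eval_generic_def mev_const mev_var embed_const_hom coords_simps)

private lemma eval_generic_forms:
  "eval_generic w1 w2 w3 sum12 = par_a" "eval_generic w1 w2 w3 sum34 = par_b"
  "eval_generic w1 w2 w3 (pair_form (A + 1) 1) = par_a * par_b * w1"
  "eval_generic w1 w2 w3 (pair_form (A + 1) 3) = par_a * par_b * w2"
  "eval_generic w1 w2 w3 (mvar 1 * sum34 + pair_form (A + 1) 1) = par_b * (par_a + par_b) * w3"
proof -
  note H = unital_hom_simps[OF eval_generic_hom[of w1 w2 w3]] eval_generic_vals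
  note c2 = char2[OF two_eq_0_hom[OF embed_const_hom two]]
  note q = point_pair_quads[OF two l w]
  show ab: "eval_generic w1 w2 w3 sum12 = par_a" "eval_generic w1 w2 w3 sum34 = par_b"
    unfolding sum12_def sum34_def H by (rule c2)+
  have "eval_generic w1 w2 w3 (pair_form (A + 1) 1) = pair_quad (embed_const (A + 1)) par_a (par_a + par_b) (point_x1 w1 w3) + par_b * point_x1 w1 w3"
    unfolding pair_form_def H pair_quad_def by (simp add: power2_eq_square algebra_simps c2)
  also have "\<dots> = par_a * par_b * w1"
    unfolding q by (simp add: point_x1_def algebra_simps c2)
  finally show n: "eval_generic w1 w2 w3 (pair_form (A + 1) 1) = par_a * par_b * w1" .
  have "eval_generic w1 w2 w3 (pair_form (A + 1) 3) = pair_quad (embed_const (A + 1)) par_b (par_a + par_b) (point_x3 w2 w3) + par_a * point_x3 w2 w3"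
    unfolding pair_form_def H pair_quad_def by (simp add: power2_eq_square algebra_simps c2)
  also have "\<dots> = par_a * par_b * w2"
    unfolding q by (simp add: point_x3_def algebra_simps c2)
  finally show "eval_generic w1 w2 w3 (pair_form (A + 1) 3) = par_a * par_b * w2" .
  show "eval_generic w1 w2 w3 (mvar 1 * sum34 + pair_form (A + 1) 1) = par_b * (par_a + par_b) * w3"
    unfolding H n ab by (simp add: point_x1_def algebra_simps c2)
qed

text \<open>The witnesses are \<open>x = b / a\<close> and the functions \<open>y\<^sub>1, y\<^sub>2, y\<^sub>3\<close> defined by the forms above. Adjoining \<open>y\<^sub>1\<close>, \<open>y\<^sub>3\<close>, \<open>y\<^sub>2\<close> in this order to \<open>k(x)\<close> gives three
  quadratic steps, because the corresponding steps over the larger field \<open>k(a)(b)\<close> are proper. The top of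
  the tower is everything because it contains all the quotients \<open>x\<^sub>i / x\<^sub>0\<close>.\<close>

lemma function_field_is_fibre_product:
  defines "I \<equiv> curve_ideal A B"
  defines "K \<equiv> function_field I"
  defines "c \<equiv> const_fn I"
  shows "\<exists>x \<in> carrier K. x \<noteq> \<zero>\<^bsub>K\<^esub> \<and>
          is_fibre_product K (c ` UNIV) x
            (c l \<otimes>\<^bsub>K\<^esub> x [^]\<^bsub>K\<^esub> (3::nat) \<oplus>\<^bsub>K\<^esub> c l \<otimes>\<^bsub>K\<^esub> inv\<^bsub>K\<^esub> x)
            (c l \<otimes>\<^bsub>K\<^esub> inv\<^bsub>K\<^esub> (x [^]\<^bsub>K\<^esub> (3::nat)) \<oplus>\<^bsub>K\<^esub> c l \<otimes>\<^bsub>K\<^esub> x)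
            (c l \<otimes>\<^bsub>K\<^esub> x \<oplus>\<^bsub>K\<^esub> c l \<otimes>\<^bsub>K\<^esub> inv\<^bsub>K\<^esub> x \<oplus>\<^bsub>K\<^esub> c (A + 1))"
proof -
  define \<phi> where "\<phi> = eval_generic w1 w2 w3"
  interpret V: value_field \<phi> I
    by unfold_locales (auto simp: \<phi>_def eval_generic_hom I_def eval_generic_kernel[OF two l w])
  interpret E: field_embedding K V.val
    unfolding K_def by (rule V.embedding)
  note two_genfield = two_eq_0_hom[OF embed_const_hom two]
  note H = unital_hom_simps[OF eval_generic_hom[of w1 w2 w3]]
  have nz: "par_a \<noteq> (0 :: 'a genfield)" "par_b \<noteq> (0 :: 'a genfield)" "par_a + par_b \<noteq> (0 :: 'a genfield)"
    by (rule parameters_nonzero)+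
  have c: "c a \<in> carrier K" "V.val (c a) = embed_const a" for a
  proof -
    show "c a \<in> carrier K"
      unfolding c_def K_def by (rule V.val_const(2))
    have "V.val (c a) = \<phi> (mconst a)"
      unfolding c_def by (rule V.val_const(1))
    then show "V.val (c a) = embed_const a"
      by (simp add: \<phi>_def eval_generic_vals)
  qed
  have elem: "frac I f g \<in> carrier K \<and> V.val (frac I f g) = \<phi> f / \<phi> g"
    if "homogeneous d f" "homogeneous d g" "\<phi> g \<noteq> 0" for f g d
  proof -
    have "(f, g) \<in> frac_pairs I"
      using that unfolding V.pairs_iff by blast
    then show ?thesis
      unfolding K_def using V.val_frac V.frac_carrier by blast
  qed
  define x where "x = frac I sum34 sum12"
  define z1 where "z1 = frac I (pair_form (A + 1) 1) (sum12 * sum34)"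
  define z2 where "z2 = frac I (pair_form (A + 1) 3) (sum12 * sum34)"
  define z3 where "z3 = frac I (mvar 1 * sum34 + pair_form (A + 1) 1) (sum34 * mvar 0)"
  have ff: "\<phi> sum12 = par_a" "\<phi> sum34 = par_b" "\<phi> (sum12 * sum34) = par_a * par_b" "\<phi> (sum34 * mvar 0) = par_b * (par_a + par_b)"
    "\<phi> (pair_form (A + 1) 1) = par_a * par_b * w1" "\<phi> (pair_form (A + 1) 3) = par_a * par_b * w2"
    "\<phi> (mvar 1 * sum34 + pair_form (A + 1) 1) = par_b * (par_a + par_b) * w3"
    unfolding \<phi>_def eval_generic_forms by (simp_all only: H eval_generic_forms eval_generic_vals)
  have x: "x \<in> carrier K" "V.val x = par_b / par_a"
    using elem[OF homogeneous_forms(2,1)] ff nz by (simp_all add: x_def)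
  have z1: "z1 \<in> carrier K" "V.val z1 = w1"
    using elem[OF homogeneous_forms(3,4), of "A + 1" 1] ff nz by (simp_all add: z1_def)
  have z2: "z2 \<in> carrier K" "V.val z2 = w2"
    using elem[OF homogeneous_forms(3,4), of "A + 1" 3] ff nz by (simp_all add: z2_def)
  have z3: "z3 \<in> carrier K" "V.val z3 = w3"
    using elem[OF homogeneous_forms(6,5), of "A + 1"] ff nz by (simp_all add: z3_def)
  have x0: "x \<noteq> \<zero>\<^bsub>K\<^esub>"
    using E.T_eq_0_iff[OF x(1)] x(2) nz by simp
  then have x30: "x [^]\<^bsub>K\<^esub> (3::nat) \<noteq> \<zero>\<^bsub>K\<^esub>"
    using x nz by (subst E.T_eq_0_iff[symmetric]) (simp_all add: E.T_pow)
  have ix: "inv\<^bsub>K\<^esub> x \<in> carrier K" "inv\<^bsub>K\<^esub> (x [^]\<^bsub>K\<^esub> (3::nat)) \<in> carrier K"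
    using x x0 x30 by (simp_all add: E.nonzero_inv_closed)
  define f1 where "f1 = c l \<otimes>\<^bsub>K\<^esub> x [^]\<^bsub>K\<^esub> (3::nat) \<oplus>\<^bsub>K\<^esub> c l \<otimes>\<^bsub>K\<^esub> inv\<^bsub>K\<^esub> x"
  define f2 where "f2 = c l \<otimes>\<^bsub>K\<^esub> inv\<^bsub>K\<^esub> (x [^]\<^bsub>K\<^esub> (3::nat)) \<oplus>\<^bsub>K\<^esub> c l \<otimes>\<^bsub>K\<^esub> x"
  define f3 where "f3 = c l \<otimes>\<^bsub>K\<^esub> x \<oplus>\<^bsub>K\<^esub> c l \<otimes>\<^bsub>K\<^esub> inv\<^bsub>K\<^esub> x \<oplus>\<^bsub>K\<^esub> c (A + 1)"
  have f: "f1 \<in> carrier K" "f2 \<in> carrier K" "f3 \<in> carrier K"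
    unfolding f1_def f2_def f3_def by (simp_all add: c x ix)
  have vf: "V.val f1 = w1 ^ 2 + w1" "V.val f2 = w2 ^ 2 + w2" "V.val f3 = w3 ^ 2 + w3"
    using w unfolding generic_roots_def f1_def f2_def f3_def rhs1_def rhs2_def rhs3_def
    by (simp_all add: E.T_add E.T_mult E.T_inv E.T_pow c x ix x0 x30 divide_inverse)
  have roots: "z1 [^]\<^bsub>K\<^esub> (2::nat) \<oplus>\<^bsub>K\<^esub> z1 = f1" "z2 [^]\<^bsub>K\<^esub> (2::nat) \<oplus>\<^bsub>K\<^esub> z2 = f2"
    "z3 [^]\<^bsub>K\<^esub> (2::nat) \<oplus>\<^bsub>K\<^esub> z3 = f3"
    by (subst E.T_eq_iff[symmetric]; simp add: z1 z2 z3 f vf E.T_add E.T_pow)+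
  define k where "k = c ` UNIV"
  have kK: "k \<subseteq> carrier K"
    using c by (auto simp: k_def)
  have Vk: "V.val ` k = range embed_const"
    by (simp add: k_def image_image c)
  have subk: "subfield k K"
  proof (rule E.subfield_from_image[OF kK])
    have "inverse (embed_const a) = embed_const (inverse a)" for a :: 'a
    proof (cases "a = 0")
      case False
      then have "embed_const a * embed_const (inverse a) = 1"
        by (simp add: unital_hom_simps(1)[OF embed_const_hom] flip: unital_hom_simps(3)[OF embed_const_hom])
      then show ?thesis
        by (metis inverse_unique)
    qed (simp add: unital_hom_simps[OF embed_const_hom])
    then show "subfield_set (V.val ` k)"
      unfolding Vk subfield_set_def
      by (auto simp flip: unital_hom_simps(3,6)[OF embed_const_hom]) (metis unital_hom_simps(1)[OF embed_const_hom] rangeI)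
  qed
  define F where "F = generate_field K (k \<union> {x})"
  have kx: "k \<union> {x} \<subseteq> carrier K"
    using kK x by blast
  have subF: "subfield F K"
    unfolding F_def by (rule E.generate_field_is_subfield[OF kx])
  have FK: "F \<subseteq> carrier K"
    using subfieldE(3)[OF subF] .
  have VF: "V.val ` F \<subseteq> base"
    unfolding F_def
  proof (rule E.image_generate_field[OF kx _ base_subfield_set])
    have "par_b / par_a \<in> (base :: 'a genfield set)"
      by (rule subfield_set_closed(8)[OF base_subfield_set parameters_in_base(2,1)])
    moreover have "range embed_const \<subseteq> (base :: 'a genfield set)"
      by (rule image_subsetI) (rule parameters_in_base)
    ultimately show "V.val ` (k \<union> {x}) \<subseteq> base"
      unfolding image_Un Vk image_insert image_empty x(2) by blast
  qed
  have mem: "c a \<in> F" "x \<in> F" for a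
    unfolding F_def by (auto intro!: generate_field.incl simp: k_def)
  have imem: "inv\<^bsub>K\<^esub> x \<in> F" "inv\<^bsub>K\<^esub> (x [^]\<^bsub>K\<^esub> (3::nat)) \<in> F" "x [^]\<^bsub>K\<^esub> (3::nat) \<in> F"
  proof -
    show p: "x [^]\<^bsub>K\<^esub> (3::nat) \<in> F"
      using mem(2) unfolding F_def by (simp add: numeral_3_eq_3 generate_field.eng_mult generate_field.one)
    show "inv\<^bsub>K\<^esub> x \<in> F" "inv\<^bsub>K\<^esub> (x [^]\<^bsub>K\<^esub> (3::nat)) \<in> F"
      using mem(2) p x0 x30 unfolding F_def by (auto intro: generate_field.m_inv)
  qed
  have fF: "f1 \<in> F" "f2 \<in> F" "f3 \<in> F"
    using mem imem unfolding f1_def f2_def f3_def F_def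
    by (auto intro!: generate_field.eng_add generate_field.eng_mult)
  have trans: "ring.transcendental K k x"
  proof -
    have "a_kernel (univ_poly K k) K (\<lambda>p. ring.eval K p x) = {[]}"
    proof -
      have "p = []" if p: "polynomial\<^bsub>K\<^esub> k p" and e: "E.eval p x = \<zero>\<^bsub>K\<^esub>" for p
      proof (rule ccontr)
        assume ne: "p \<noteq> []"
        then have pk: "set p \<subseteq> k" "hd p \<noteq> \<zero>\<^bsub>K\<^esub>"
          using p by (simp_all add: polynomial_def)
        then obtain cs where cs: "p = map c cs"
          unfolding k_def by (metis ex_map_conv image_iff subset_iff)
        have "peval embed_const (par_b / par_a) (Poly (rev cs)) = 0"
          using E.eval_as_peval[OF embed_const_hom c x(1), of cs] e E.T_zero unfolding cs x(2) by simp
        then have "Poly (rev cs) = 0"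
          by (rule ratio_transcendental)
        then obtain n where "rev cs = replicate n 0"
          by (auto simp: Poly_eq_0)
        then have "set cs \<subseteq> {0}"
          by (metis set_rev set_replicate_conv_if empty_subsetI order_refl)
        then have "hd cs = 0"
          using ne cs by (cases cs) auto
        then have "V.val (hd p) = 0"
          using ne cs by (simp add: hd_map c unital_hom_simps[OF embed_const_hom])
        moreover have "hd p \<in> carrier K"
          using ne pk(1) kK by (auto simp: subset_iff)
        ultimately show False
          using pk(2) E.T_eq_0_iff by blast
      qed
      then show ?thesis
        unfolding a_kernel_def' by (auto simp: univ_poly_carrier[symmetric])
    qed
    then show ?thesis
      using E.trivial_ker_imp_transcendental[OF subfieldE(1)[OF subk] x(1)] by (simp add: over_def)
  qed
  have H1: "F \<union> {z1} \<subseteq> carrier K"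
    using FK z1 by blast
  define D1 where "D1 = generate_field K (F \<union> {z1})"
  have sub1: "subfield D1 K"
    unfolding D1_def by (rule E.generate_field_is_subfield[OF H1])
  have H2: "D1 \<union> {z3} \<subseteq> carrier K"
    using subfieldE(3)[OF sub1] z3 by blast
  define D2 where "D2 = generate_field K (D1 \<union> {z3})"
  have sub2: "subfield D2 K"
    unfolding D2_def by (rule E.generate_field_is_subfield[OF H2])
  have H3: "D2 \<union> {z2} \<subseteq> carrier K"
    using subfieldE(3)[OF sub2] z2 by blast
  define D3 where "D3 = generate_field K (D2 \<union> {z2})"
  have sub3: "subfield D3 K"
    unfolding D3_def by (rule E.generate_field_is_subfield[OF H3])
  have inc: "F \<subseteq> D1" "D1 \<subseteq> D2" "D2 \<subseteq> D3" "z1 \<in> D1" "z3 \<in> D2" "z2 \<in> D3"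
    unfolding D1_def D2_def D3_def by (auto intro: generate_field.incl)
  have up: "V.val ` (M \<union> {z}) \<subseteq> adjoin S (V.val z)" if "V.val ` M \<subseteq> S" "subfield_set S" for M z S
    using that(1) adjoin_mem[OF that(2)] by blast
  have VD1: "V.val ` D1 \<subseteq> adjoin base w1"
    unfolding D1_def
    by (rule E.image_generate_field[OF H1 up[OF VF base_subfield_set, of z1, unfolded z1(2)] tower1_subfield_set[OF two l(2) w]])
  have VD2: "V.val ` D2 \<subseteq> adjoin (adjoin base w1) w3"
    unfolding D2_def
    by (rule E.image_generate_field[OF H2 up[OF VD1 tower1_subfield_set[OF two l(2) w], of z3, unfolded z3(2)]
          tower2_subfield_set[OF two l(2) w]])
  have notF: "z1 \<notin> F" "z2 \<notin> F" "z3 \<notin> F"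
    using VF sums_not_in_base(1-3)[OF two l(2) w] z1(2) z2(2) z3(2) by blast+
  have not1: "z3 \<notin> D1"
    using VD1 y3_not_in_tower[OF two l(2) w] z3(2) by blast
  have not2: "z2 \<notin> D2"
    using VD2 y2_not_in_tower[OF two l(2) w] z2(2) by blast
  have VfF: "V.val z1 ^ 2 + V.val z1 \<in> V.val ` F" "V.val z2 ^ 2 + V.val z2 \<in> V.val ` F" "V.val z3 ^ 2 + V.val z3 \<in> V.val ` F"
    using fF unfolding z1(2) z2(2) z3(2) vf[symmetric] by blast+
  note dimF = E.artin_schreier_dimension[OF two_genfield subF]
  have d1: "E.dimension 2 F D1"
    unfolding D1_def by (rule dimF[OF z1(1) notF(1) VfF(1)])
  have d2: "E.dimension 2 D1 D2"
    unfolding D2_def by (rule E.artin_schreier_dimension[OF two_genfield sub1 z3(1) not1]) (use VfF(3) inc in blast)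
  have d3: "E.dimension 2 D2 D3"
    unfolding D3_def by (rule E.artin_schreier_dimension[OF two_genfield sub2 z2(1) not2]) (use VfF(2) inc in blast)
  have "E.dimension (2 * 2) F D2"
    by (rule E.telescopic_base[OF subF sub1 d1 d2])
  from E.telescopic_base[OF subF sub2 this d3] have d8: "E.dimension 8 F D3"
    by simp
  define G where "G = generate_field K (k \<union> {x, z1, z2, z3})"
  have HG: "k \<union> {x, z1, z2, z3} \<subseteq> carrier K"
    using kK x z1 z2 z3 by blast
  have subG: "subfield G K"
    unfolding G_def by (rule E.generate_field_is_subfield[OF HG])
  have gen: "G = carrier K"
  proof (intro subset_antisym subsetI)
    show "u \<in> carrier K" if "u \<in> G" for u
      using that subfieldE(3)[OF subG] by blast
  next
    define S where "S = V.val ` G"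
    have S: "subfield_set S"
      unfolding S_def by (rule E.image_subfield[OF subG])
    note s = subfield_set_closed[OF S]
    have "c a \<in> G" "x \<in> G" "z1 \<in> G" "z2 \<in> G" "z3 \<in> G" for a
      unfolding G_def k_def by (auto intro!: generate_field.incl)
    then have gS: "embed_const a \<in> S" "par_b / par_a \<in> S" "w1 \<in> S" "w2 \<in> S" "w3 \<in> S" for a
      unfolding S_def using c(2) x(2) z1(2) z2(2) z3(2) by (metis image_eqI)+
    have ad: "par_a / (par_a + par_b) \<in> S"
    proof -
      have "1 + par_b / par_a = (par_a + par_b) / (par_a :: 'a genfield)"
        using nz by (simp add: add_divide_distrib)
      then have "par_a / (par_a + par_b) = 1 / (1 + par_b / (par_a :: 'a genfield))"
        by simp
      then show ?thesis
        using s(1) gS(2) s(4,8) by metis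
    qed
    have bd: "par_b / (par_a + par_b) \<in> S"
    proof -
      have eq: "par_b / (par_a + par_b) = par_b / par_a * (par_a / (par_a + par_b :: 'a genfield))"
        using nz by simp
      show ?thesis
        by (subst eq) (rule s(5)[OF gS(2) ad])
    qed
    have coord: "\<phi> (mvar i) / (par_a + par_b) \<in> S" for i
    proof -
      have "(par_a + par_b) / (par_a + par_b) = (1 :: 'a genfield)"
        using nz by simp
      moreover have "point_x1 w1 w3 / (par_a + par_b) = w3 + par_a / (par_a + par_b) * w1"
        "point_x3 w2 w3 / (par_a + par_b) = w3 + 1 + par_b / (par_a + par_b) * w2"
        using nz by (simp_all add: point_x1_def point_x3_def add_divide_distrib)
      moreover have "w3 + par_a / (par_a + par_b) * w1 \<in> S" "w3 + 1 + par_b / (par_a + par_b) * w2 \<in> S"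
        by (intro s gS ad bd)+
      ultimately show ?thesis
        using index5_cases[of i] s(1,4) ad bd unfolding \<phi>_def
        by (auto simp: eval_generic_vals add_divide_distrib[of _ par_a] add_divide_distrib[of _ par_b])
    qed
    fix u assume u: "u \<in> carrier K"
    then obtain p q where pq: "u = frac I p q" "(p, q) \<in> frac_pairs I"
      unfolding K_def by (metis V.carrierE)
    then obtain d where d: "homogeneous d p" "homogeneous d q" "\<phi> q \<noteq> 0"
      unfolding V.pairs_iff by blast
    define v where "v = (\<lambda>i. \<phi> (mvar i) / (par_a + par_b))"
    \<comment> \<open>Replacing each \<open>x\<^sub>i\<close> by \<open>x\<^sub>i / x\<^sub>0\<close> turns a quotient of forms of equal degree into one of elements of \<open>S\<close>.\<close>
  have scale: "\<phi> p = (par_a + par_b) ^ d * mev embed_const v p" if "homogeneous d p" for p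
    proof -
      have "(\<lambda>i. (par_a + par_b) * v i) = coords par_a par_b (point_x1 w1 w3) (point_x3 w2 w3)"
        using nz by (intro ext) (simp add: v_def \<phi>_def eval_generic_def mev_var embed_const_hom)
      then show ?thesis
        using mev_scale[OF that, of embed_const "par_a + par_b" v] by (simp add: \<phi>_def eval_generic_def)
    qed
    have "V.val u = mev embed_const v p / mev embed_const v q"
      using pq V.val_frac[OF pq(2)] scale[OF d(1)] scale[OF d(2)] nz by simp
    moreover have "mev embed_const v p \<in> S" for p
      by (rule mev_in_subfield[OF S embed_const_hom]) (simp_all add: gS v_def coord)
    ultimately have "V.val u \<in> V.val ` G"
      using s(8) unfolding S_def by simp
    then show "u \<in> G"
      using u E.T_inj subfieldE(3)[OF subG] by (auto simp: inj_on_def subset_iff)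
  qed
  have "G \<subseteq> D3"
    unfolding G_def
    by (rule E.generate_field_min_subfield1[OF HG sub3]) (use inc mem in \<open>auto simp: k_def\<close>)
  then have D3: "D3 = carrier K"
    using gen subfieldE(3)[OF sub3] by blast
  have cover: "is_double_cover K F f1 (generate_field K (F \<union> {z1})) z1"
    "is_double_cover K F f2 (generate_field K (F \<union> {z2})) z2"
    "is_double_cover K F f3 (generate_field K (F \<union> {z3})) z3"
    unfolding is_double_cover_def using roots z1(1) z2(1) z3(1)
      dimF[OF z1(1) notF(1) VfF(1)] dimF[OF z2(1) notF(2) VfF(2)] dimF[OF z3(1) notF(3) VfF(3)] by blast+
  have "is_fibre_product K k x f1 f2 f3"
    unfolding is_fibre_product_def Let_def F_def[symmetric]
    using E.field_axioms subk x(1) trans fF cover gen[unfolded G_def] d8[unfolded D3] by blast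
  then show ?thesis
    using x(1) x0 unfolding f1_def f2_def f3_def k_def by blast
qed

end

theorem mainTheorem5:
  fixes A B lam :: "'a::{field, finite}" and q m :: nat
  assumes "q = 2 ^ m" and "CARD('a) = q"
    and "lam = B + A^2 + A + 1" and "lam \<noteq> 0"
  shows "primeideal (curve_ideal A B) mpol_ring \<and>
    (let I = curve_ideal A B;
         K = function_field I;
         c = const_fn I
     in \<exists>x \<in> carrier K. x \<noteq> \<zero>\<^bsub>K\<^esub> \<and>
          is_fibre_product K (c ` UNIV) x
            (c lam \<otimes>\<^bsub>K\<^esub> x [^]\<^bsub>K\<^esub> (3::nat) \<oplus>\<^bsub>K\<^esub> c lam \<otimes>\<^bsub>K\<^esub> inv\<^bsub>K\<^esub> x)
            (c lam \<otimes>\<^bsub>K\<^esub> inv\<^bsub>K\<^esub> (x [^]\<^bsub>K\<^esub> (3::nat)) \<oplus>\<^bsub>K\<^esub> c lam \<otimes>\<^bsub>K\<^esub> x)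
            (c lam \<otimes>\<^bsub>K\<^esub> x \<oplus>\<^bsub>K\<^esub> c lam \<otimes>\<^bsub>K\<^esub> inv\<^bsub>K\<^esub> x \<oplus>\<^bsub>K\<^esub> c (A + 1)))"
proof -
  have two: "(2::'a) = 0"
    by (rule card_power_2_imp_two_eq_0[of m]) (simp add: assms(1,2))
  obtain y1 y2 y3 where y: "generic_roots (A + 1) lam y1 y2 (y3 :: 'a genfield)"
    by (rule generic_roots_exist)
  show ?thesis
    unfolding Let_def
    using curve_ideal_prime[OF two assms(3,4) y] function_field_is_fibre_product[OF two assms(3,4) y] by blast
qed

end
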